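(* Let $s\ge 2$, $p\ge 2$ be integers and let $G_{min}(s,p)$ be the graph in $\mathcal{G}(s,p)$ with the minimum number of edges. Then the number $\ell$ of non-integer Laplacian eigenvalues of $G_{min}(s,p)$ (counted with multiplicity) satisfies $\ell=0$ or $\ell=2$.
   Context: All graphs are finite, simple and connected. The Laplacian matrix of $G$ is $L(G)=\mathcal{D}(G)-A(G)$, with $\mathcal{D}(G)$ the diagonal degree matrix and $A(G)$ the adjacency matrix; its eigenvalues are the Laplacian eigenvalues of $G$. A vertex is simplicial if its neighbourhood is a clique. A minimal vertex separator is a set $S$ that, for some non-adjacent vertices $u,v$, separates $u$ and $v$ into different components of $G-S$ and is inclusion-minimal with this property. A graph is strictly chordal if it is obtained from a block graph (connected graph all of whose blocks are cliques) by adding zero or more true twins ($N[u]=N[v]$) to each vertex; a strictly interval graph is one that is both strictly chordal and an interval graph. For integers $s,p\ge 2$, $\mathcal{G}(s,p)$ is the set of $SI$-core graphs: strictly interval graphs $G$ with exactly two minimal vertex separators $S_1,S_2$, $|S_1|=|S_2|=s$, $S_1\cup S_2$ a maximal clique of $G$, and each $S_i$ having exactly $p$ simplicial vertices adjacent to it. Explicitly, $V(G)=S_1\cup S_2\cup P_1\cup P_2$ (disjoint), $|P_i|=p$, every vertex of $P_i$ is adjacent to all of $S_i$ and to no vertex of $S_{3-i}\cup P_{3-i}$, and $G[P_i]$ is a disjoint union of complete graphs. Thus $G_{min}(s,p)$ is the member in which $P_1$ and $P_2$ are independent sets. *)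

theory Defs
  imports
    "Graph_Theory.Digraph_Component"
    "Jordan_Normal_Form.Spectral_Radius"
begin

text \<open>
  A finite simple graph is a \<^locale>\<open>pair_graph\<close>: a finite loop-free symmetric digraph without
  parallel arcs. An edge is represented by its two opposite arcs.
\<close>

definition edges :: "'a pair_pre_digraph \<Rightarrow> 'a set set" where
  "edges G = {{u, v} | u v. (u, v) \<in> parcs G}"

definition nbhd :: "'a pair_pre_digraph \<Rightarrow> 'a \<Rightarrow> 'a set" where
  "nbhd G v = {w. (v, w) \<in> parcs G}"

definition clique :: "'a pair_pre_digraph \<Rightarrow> 'a set \<Rightarrow> bool" where
  "clique G K \<longleftrightarrow> K \<subseteq> pverts G \<and> (\<forall>u\<in>K. \<forall>v\<in>K. u \<noteq> v \<longrightarrow> (u, v) \<in> parcs G)"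

definition maximal_clique :: "'a pair_pre_digraph \<Rightarrow> 'a set \<Rightarrow> bool" where
  "maximal_clique G K \<longleftrightarrow> clique G K \<and> (\<forall>K'. clique G K' \<and> K \<subseteq> K' \<longrightarrow> K' = K)"

definition simplicial :: "'a pair_pre_digraph \<Rightarrow> 'a \<Rightarrow> bool" where
  "simplicial G v \<longleftrightarrow> v \<in> pverts G \<and> clique G (nbhd G v)"

subsection \<open>Minimal vertex separators\<close>

definition separates :: "'a pair_pre_digraph \<Rightarrow> 'a set \<Rightarrow> 'a \<Rightarrow> 'a \<Rightarrow> bool" where
  "separates G S u v \<longleftrightarrow> S \<subseteq> pverts G \<and> u \<in> pverts G - S \<and> v \<in> pverts G - S \<and>
     \<not> (u \<rightarrow>\<^sup>*\<^bsub>with_proj G \<restriction> (pverts G - S)\<^esub> v)"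

text \<open>Minimality is relative to the pair separated; the set may properly contain a separator
  of another pair.\<close>

definition minimal_vertex_separator :: "'a pair_pre_digraph \<Rightarrow> 'a set \<Rightarrow> bool" where
  "minimal_vertex_separator G S \<longleftrightarrow>
     (\<exists>u\<in>pverts G. \<exists>v\<in>pverts G. u \<noteq> v \<and> (u, v) \<notin> parcs G \<and> separates G S u v \<and>
        (\<forall>T. T \<subset> S \<longrightarrow> \<not> separates G T u v))"

subsection \<open>Block graphs and strictly chordal graphs\<close>

text \<open>
  A cut vertex is one whose removal disconnects two vertices that were connected before.
  A block is a maximal connected subgraph without a cut vertex of its own; such a subgraph is
  induced, so it is given by its vertex set.
\<close>

definition cut_vertex :: "('a, 'b) pre_digraph \<Rightarrow> 'a \<Rightarrow> bool" where
  "cut_vertex H x \<longleftrightarrow> x \<in> verts H \<and>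
     (\<exists>u \<in> verts H - {x}. \<exists>v \<in> verts H - {x}.
        u \<rightarrow>\<^sup>*\<^bsub>H\<^esub> v \<and> \<not> (u \<rightarrow>\<^sup>*\<^bsub>H \<restriction> (verts H - {x})\<^esub> v))"

definition nonseparable :: "('a, 'b) pre_digraph \<Rightarrow> bool" where
  "nonseparable H \<longleftrightarrow> Digraph_Component.connected H \<and> (\<nexists>x. cut_vertex H x)"

definition block :: "'a pair_pre_digraph \<Rightarrow> 'a set \<Rightarrow> bool" where
  "block G B \<longleftrightarrow> B \<subseteq> pverts G \<and> nonseparable (with_proj G \<restriction> B) \<and>
     (\<forall>C. B \<subset> C \<and> C \<subseteq> pverts G \<longrightarrow> \<not> nonseparable (with_proj G \<restriction> C))"

definition block_graph :: "'a pair_pre_digraph \<Rightarrow> bool" where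
  "block_graph G \<longleftrightarrow> pair_graph G \<and> Digraph_Component.connected (with_proj G) \<and>
     (\<forall>B. block G B \<longrightarrow> clique G B)"

text \<open>Adds a new vertex \<open>w\<close> with the same closed neighbourhood as \<open>v\<close>.\<close>

definition add_true_twin :: "'a pair_pre_digraph \<Rightarrow> 'a \<Rightarrow> 'a \<Rightarrow> 'a pair_pre_digraph" where
  "add_true_twin G v w =
     \<lparr> pverts = insert w (pverts G),
       parcs = parcs G \<union> {w} \<times> insert v (nbhd G v) \<union> insert v (nbhd G v) \<times> {w} \<rparr>"

inductive strictly_chordal :: "'a pair_pre_digraph \<Rightarrow> bool" where
  block_graph: "block_graph G \<Longrightarrow> strictly_chordal G"
| true_twin: "strictly_chordal G \<Longrightarrow> v \<in> pverts G \<Longrightarrow> w \<notin> pverts G \<Longrightarrow>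
    strictly_chordal (add_true_twin G v w)"

subsection \<open>Strictly interval graphs and SI-core graphs\<close>

definition interval_graph :: "'a pair_pre_digraph \<Rightarrow> bool" where
  "interval_graph G \<longleftrightarrow> pair_graph G \<and>
     (\<exists>l r :: 'a \<Rightarrow> real. (\<forall>v\<in>pverts G. l v \<le> r v) \<and>
        (\<forall>u\<in>pverts G. \<forall>v\<in>pverts G. u \<noteq> v \<longrightarrow>
           ((u, v) \<in> parcs G \<longleftrightarrow> {l u..r u} \<inter> {l v..r v} \<noteq> {})))"

definition strictly_interval :: "'a pair_pre_digraph \<Rightarrow> bool" where
  "strictly_interval G \<longleftrightarrow> strictly_chordal G \<and> interval_graph G"

text \<open>A vertex is adjacent to a set if it is adjacent to all of its elements. For a minimal vertex
  separator of a strictly chordal graph and a vertex outside it, this is the same as being adjacent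
  to some element.\<close>

definition simplicial_at :: "'a pair_pre_digraph \<Rightarrow> 'a set \<Rightarrow> 'a set" where
  "simplicial_at G S = {v \<in> pverts G. simplicial G v \<and> S \<subseteq> nbhd G v}"

definition SI_core :: "nat \<Rightarrow> nat \<Rightarrow> 'a pair_pre_digraph \<Rightarrow> bool" where
  "SI_core s p G \<longleftrightarrow> strictly_interval G \<and>
     (\<exists>S1 S2. S1 \<noteq> S2 \<and> {S. minimal_vertex_separator G S} = {S1, S2} \<and>
        card S1 = s \<and> card S2 = s \<and> maximal_clique G (S1 \<union> S2) \<and>
        card (simplicial_at G S1) = p \<and> card (simplicial_at G S2) = p)"

text \<open>All members of the class have \<open>2 * (s + p)\<close> vertices, so it makes no difference that the
  minimum is taken over graphs with vertices in one fixed type.\<close>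

definition is_G_min :: "nat \<Rightarrow> nat \<Rightarrow> 'a pair_pre_digraph \<Rightarrow> bool" where
  "is_G_min s p G \<longleftrightarrow> is_arg_min (\<lambda>H. card (edges H)) (SI_core s p) G"

subsection \<open>Laplacian eigenvalues\<close>

text \<open>The list \<open>vs\<close> enumerates the vertices, without repetitions, as row and column indices.\<close>

definition degree_matrix :: "'a pair_pre_digraph \<Rightarrow> 'a list \<Rightarrow> complex mat" where
  "degree_matrix G vs = mat (length vs) (length vs)
     (\<lambda>(i, j). if i = j then of_nat (card (nbhd G (vs ! i))) else 0)"

definition adjacency_matrix :: "'a pair_pre_digraph \<Rightarrow> 'a list \<Rightarrow> complex mat" where
  "adjacency_matrix G vs = mat (length vs) (length vs)
     (\<lambda>(i, j). if (vs ! i, vs ! j) \<in> parcs G then 1 else 0)"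

definition laplacian_matrix :: "'a pair_pre_digraph \<Rightarrow> 'a list \<Rightarrow> complex mat" where
  "laplacian_matrix G vs = degree_matrix G vs - adjacency_matrix G vs"

definition num_nonint_eigenvalues :: "complex mat \<Rightarrow> nat" where
  "num_nonint_eigenvalues A = (\<Sum>x \<in> {x \<in> spectrum A. x \<notin> \<int>}. order x (char_poly A))"

end

theory Submission
  imports Defs
begin

text \<open>
  In an \<open>SI\<close>-core graph all but two dimensions are spanned by Laplacian eigenfunctions with integer
  eigenvalues. These are the constants (\<open>0\<close>), the function \<open>p\<close> on \<open>S\<^sub>1 \<union> S\<^sub>2\<close> and \<open>-s\<close> on
  \<open>P\<^sub>1 \<union> P\<^sub>2\<close> (\<open>s + p\<close>), differences of indicators of true twins (the common degree plus one), and
  differences of normalised indicators of two components of \<open>P\<^sub>i\<close> (\<open>s\<close>). The trace is an integer, so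
  the remaining two eigenvalues have integer sum and are both integers or both not.

  The structure of \<open>G\<close> follows from one property of strictly chordal graphs: two non-adjacent
  neighbours of \<open>x\<close> lie in different components once the twin class of \<open>x\<close> is removed. It makes
  every minimal vertex separator a single twin class.
\<close>

section \<open>Matrices with integer eigenvalues up to corank two\<close>

lemma order_prod_linear:
  "order x (\<Prod>a\<leftarrow>as. [:- a, 1:]) = count_list as (x :: 'a :: field)"
proof (induction as)
  case (Cons a as)
  have nz: "(\<Prod>a\<leftarrow>as. [:- a, 1:]) \<noteq> 0"
    by (auto simp: prod_list_zero_iff)
  have "order x [:- a, 1:] = (if x = a then 1 else 0)"
    using order_power_n_n[of a 1] by (auto intro: order_0I)
  moreover have "order x ([:- a, 1:] * (\<Prod>a\<leftarrow>as. [:- a, 1:])) =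
      order x [:- a, 1:] + order x (\<Prod>a\<leftarrow>as. [:- a, 1:])"
    by (rule order_mult) (use nz in \<open>metis mult_eq_0_iff pCons_eq_0_iff zero_neq_one\<close>)
  ultimately show ?case
    using Cons by (simp del: mult_pCons_left)
qed auto

text \<open>Once the characteristic polynomial splits into linear factors, multiplicity of a root is
  its number of occurrences in \<open>as\<close>, so counting eigenvalues becomes filtering a
  list.\<close>

lemma num_nonint_eigenvalues_factorized:
  assumes A: "A \<in> carrier_mat n n" and cp: "char_poly A = (\<Prod>a\<leftarrow>as. [:- a, 1:])"
  shows "num_nonint_eigenvalues A = length (filter (\<lambda>x. x \<notin> \<int>) as)"
proof -
  let ?bs = "filter (\<lambda>x. x \<notin> \<int>) as"
  have "spectrum A = set as"
    by (auto simp: spectrum_root_char_poly[OF A] cp poly_prod_list prod_list_zero_iff)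
  then have "num_nonint_eigenvalues A = (\<Sum>x\<in>set ?bs. count_list as x)"
    unfolding num_nonint_eigenvalues_def cp order_prod_linear by (intro sum.cong) auto
  also have "\<dots> = (\<Sum>x\<in>set ?bs. count_list ?bs x)"
  proof (intro sum.cong refl)
    fix x assume "x \<in> set ?bs"
    then have "x \<notin> \<int>" by simp
    then show "count_list as x = count_list ?bs x"
      by (induction as) auto
  qed
  also have "\<dots> = length ?bs"
    by (rule sum_count_set) auto
  finally show ?thesis .
qed

lemma index_mult_mat_sum:
  assumes "A \<in> carrier_mat n m" "B \<in> carrier_mat m k" "i < n" "j < k"
  shows "(A * B) $$ (i, j) = (\<Sum>l<m. A $$ (i, l) * B $$ (l, j))"
  using assms by (simp add: scalar_prod_def lessThan_atLeast0)

lemma trace_mult_commute: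
  assumes "A \<in> carrier_mat n m" "B \<in> carrier_mat m n"
  shows "(\<Sum>i<n. (A * B) $$ (i, i)) = (\<Sum>i<m. (B * A) $$ (i, i) :: 'a :: comm_semiring_0)"
proof -
  have "(\<Sum>i<n. (A * B) $$ (i, i)) = (\<Sum>i<n. \<Sum>j<m. A $$ (i, j) * B $$ (j, i))"
    using assms by (intro sum.cong) (simp_all add: index_mult_mat_sum del: index_mult_mat)
  also have "\<dots> = (\<Sum>j<m. \<Sum>i<n. B $$ (j, i) * A $$ (i, j))"
    by (subst sum.swap) (simp add: mult.commute)
  also have "\<dots> = (\<Sum>i<m. (B * A) $$ (i, i))"
    using assms by (intro sum.cong) (simp_all add: index_mult_mat_sum del: index_mult_mat)
  finally show ?thesis .
qed

lemma det_dim2: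
  assumes "A \<in> carrier_mat 2 2"
  shows "det A = A $$ (0, 0) * A $$ (1, 1) - A $$ (0, 1) * A $$ (1, 0)"
proof -
  have "{0..<2} = {0, 1 :: nat}" by auto
  moreover have "Transposition.transpose 0 (1 :: nat) \<noteq> id"
    by (metis id_apply transpose_apply_first zero_neq_one)
  ultimately show ?thesis
    by (simp add: det_def'[OF assms] permutes_doubleton_iff Collect_disj_eq sign_swap_id)
qed

lemma char_poly_dim2:
  assumes "A \<in> carrier_mat 2 2"
  shows "char_poly A = [: det A, - (A $$ (0, 0) + A $$ (1, 1)), 1 :]"
proof -
  have C: "char_poly_matrix A \<in> carrier_mat 2 2"
    using assms by simp
  show ?thesis
    unfolding char_poly_def det_dim2[OF C] using assms
    by (simp add: char_poly_matrix_def det_dim2 algebra_simps)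
qed

text \<open>The first \<open>m\<close> rows of \<open>R\<close> are left eigenvectors of
  \<open>A\<close>; its last two rows complete them to a basis. In that basis \<open>A\<close> is
  block lower triangular, with a diagonal block carrying the \<open>k i\<close> and a two-by-two
  block whose trace is the integer trace of \<open>A\<close> minus the integers \<open>k i\<close>.
  The two eigenvalues of the small block have integer sum, so both are integers or neither
  is.\<close>

lemma num_nonint_eigenvalues_corank2:
  fixes A R :: "complex mat"
  assumes A: "A \<in> carrier_mat (m + 2) (m + 2)" and R: "R \<in> carrier_mat (m + 2) (m + 2)"
    and det: "det R \<noteq> 0"
    and k: "\<And>i. i < m \<Longrightarrow> k i \<in> \<int>"
    and ev: "\<And>i j. i < m \<Longrightarrow> j < m + 2 \<Longrightarrow> (R * A) $$ (i, j) = k i * R $$ (i, j)"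
    and tr: "(\<Sum>i<m + 2. A $$ (i, i)) \<in> \<int>"
  shows "num_nonint_eigenvalues A = 0 \<or> num_nonint_eigenvalues A = 2"
proof -
  let ?n = "m + 2"
  from det_non_zero_imp_unit[OF R det, unfolded Units_def, of "()"]
  obtain Q where Q: "Q \<in> carrier_mat ?n ?n" and RQ: "R * Q = 1\<^sub>m ?n" and QR: "Q * R = 1\<^sub>m ?n"
    by (auto simp: ring_mat_def)
  define T where "T = R * A * Q"
  have T: "T \<in> carrier_mat ?n ?n" using A R Q by (simp add: T_def)
  have "similar_mat T A"
    by (rule similar_matI[of _ _ R Q ?n]) (use A R Q RQ QR T in \<open>auto simp: T_def\<close>)
  then have cpT: "char_poly A = char_poly T"
    by (simp add: char_poly_similar)
  have trT: "(\<Sum>i<?n. T $$ (i, i)) = (\<Sum>i<?n. A $$ (i, i))"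
  proof -
    have "Q * (R * A) = A"
      using A R Q QR by (simp flip: assoc_mult_mat[OF Q R A])
    then show ?thesis
      unfolding T_def using A R Q by (subst trace_mult_commute[of _ ?n ?n]) auto
  qed
  have Trow: "T $$ (i, j) = (if i = j then k i else 0)" if i: "i < m" and j: "j < ?n" for i j
  proof -
    have "T $$ (i, j) = (\<Sum>l<?n. (R * A) $$ (i, l) * Q $$ (l, j))"
      unfolding T_def by (rule index_mult_mat_sum[of _ ?n ?n _ ?n]) (use A R Q i j in auto)
    also have "\<dots> = k i * (\<Sum>l<?n. R $$ (i, l) * Q $$ (l, j))"
      using i by (simp add: ev sum_distrib_left mult.assoc distrib_left del: index_mult_mat)
    also have "(\<Sum>l<?n. R $$ (i, l) * Q $$ (l, j)) = (R * Q) $$ (i, j)"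
      using i j by (intro index_mult_mat_sum[OF R Q, symmetric]) auto
    finally show ?thesis using i j by (simp add: RQ)
  qed
  obtain D Z B C where split: "split_block T m m = (D, Z, B, C)"
    by (metis prod_cases4)
  note sb = split_block[OF split, of 2 2]
  have blocks: "D \<in> carrier_mat m m" "Z \<in> carrier_mat m 2" "B \<in> carrier_mat 2 m"
    "C \<in> carrier_mat 2 2" and T4: "T = four_block_mat D Z B C"
    using sb T by auto
  have D_entry: "D $$ (i, j) = (if i = j then k i else 0)" if "i < m" "j < m" for i j
    using Trow[of i j] that blocks by (simp add: T4)
  have "Z $$ (i, j) = 0" if "i < m" "j < 2" for i j
    using Trow[of i "m + j"] that blocks by (simp add: T4)
  then have Z: "Z = 0\<^sub>m m 2" using blocks by (intro eq_matI) auto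
  define ks where "ks = diag_mat D"
  have cpD: "char_poly D = (\<Prod>a\<leftarrow>ks. [:- a, 1:])"
    unfolding ks_def
    by (rule char_poly_upper_triangular[of _ m])
       (use blocks in \<open>auto simp: upper_triangular_def D_entry\<close>)
  have ks: "set ks \<subseteq> \<int>"
    using blocks k by (auto simp: ks_def diag_mat_def D_entry)
  obtain cs where cpC: "char_poly C = (\<Prod>a\<leftarrow>cs. [:- a, 1:])" and "length cs = 2"
    using char_poly_factorized[OF blocks(4)] by auto
  then obtain a b where cs: "cs = [a, b]"
    by (auto simp: length_Suc_conv numeral_2_eq_2)
  \<comment> \<open>Comparing the coefficients of degree one: the sum of the two roots is the trace
    of \<open>C\<close>.\<close>
  have "- (a + b) = - (C $$ (0, 0) + C $$ (1, 1))"
    using cpC char_poly_dim2[OF blocks(4)] by (auto simp: cs)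
  then have "a + b = C $$ (0, 0) + C $$ (1, 1)"
    by (simp only: neg_equal_iff_equal)
  also have "\<dots> = (\<Sum>i<?n. A $$ (i, i)) - (\<Sum>i<m. k i)"
  proof -
    have "(\<Sum>i<?n. T $$ (i, i)) = (\<Sum>i<m. k i) + (T $$ (m, m) + T $$ (m + 1, m + 1))"
      by (simp add: Trow numeral_2_eq_2)
    moreover have "T $$ (m, m) = C $$ (0, 0)" "T $$ (m + 1, m + 1) = C $$ (1, 1)"
      using blocks by (auto simp: T4)
    ultimately show ?thesis unfolding trT by simp
  qed
  also have "\<dots> \<in> \<int>"
    using tr k by (intro Ints_diff) (auto intro!: Ints_sum)
  finally have ab: "a + b \<in> \<int>" .
  then have "a \<in> \<int> \<longleftrightarrow> b \<in> \<int>"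
    by (metis Ints_diff add_diff_cancel_left' add_diff_cancel_right')
  \<comment> \<open>The upper right block of \<open>T\<close> is zero, so its characteristic
    polynomial is the product of those of \<open>D\<close> and \<open>C\<close>.\<close>
  moreover have "char_poly A = (\<Prod>a\<leftarrow>ks @ cs. [:- a, 1:])"
    unfolding cpT
    by (subst char_poly_0_block'[OF T4[unfolded Z] _ _ blocks(1,3,4)]) (use cpD cpC in auto)
  then have "num_nonint_eigenvalues A = length (filter (\<lambda>x. x \<notin> \<int>) (ks @ cs))"
    by (rule num_nonint_eigenvalues_factorized[OF A])
  moreover have "filter (\<lambda>x. x \<notin> \<int>) ks = []"
    using ks by (auto simp: filter_empty_conv)
  ultimately show ?thesis
    by (auto simp: cs)
qed

section \<open>Separators of strictly chordal graphs\<close>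

lemma pair_graph_iff:
  "pair_graph G \<longleftrightarrow> finite (pverts G) \<and> parcs G \<subseteq> pverts G \<times> pverts G \<and>
     sym (parcs G) \<and> (\<forall>x. (x, x) \<notin> parcs G)"
proof
  assume "pair_graph G"
  then interpret pair_graph G .
  show "finite (pverts G) \<and> parcs G \<subseteq> pverts G \<times> pverts G \<and>
     sym (parcs G) \<and> (\<forall>x. (x, x) \<notin> parcs G)"
    using pair_finite_verts arc_fst_in_verts arc_snd_in_verts pair_sym_arcs pair_no_loops
    by (fastforce simp: symmetric_def)
next
  assume *: "finite (pverts G) \<and> parcs G \<subseteq> pverts G \<times> pverts G \<and>
     sym (parcs G) \<and> (\<forall>x. (x, x) \<notin> parcs G)"
  then have "finite (parcs G)"
    by (meson finite_SigmaI finite_subset)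
  with * show "pair_graph G"
    by unfold_locales (auto simp: symmetric_def)
qed

lemma rtrancl_on_Restr:
  assumes "Y \<subseteq> X"
  shows "rtrancl_on Y (Restr r X) = rtrancl_on Y r"
proof -
  have "(a, b) \<in> rtrancl_on Y (Restr r X)" if "(a, b) \<in> rtrancl_on Y r" for a b
    using that
    by (induction rule: rtrancl_on_induct)
       (use assms in \<open>auto intro: rtrancl_on_into_rtrancl_on\<close>)
  then show ?thesis
    using rtrancl_on_mono[of "Restr r X" r Y Y] by auto
qed

text \<open>\<open>rtrancl_on Y\<close> keeps every vertex of a walk inside \<open>Y\<close>, so
  restricting to a larger set first changes nothing. The nested form arises in
  \<open>cut_vertex\<close>, where a vertex is removed from an already induced subgraph.\<close>

lemma reachable_induce_iff:
  assumes "Y \<subseteq> X"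
  shows "u \<rightarrow>\<^sup>*\<^bsub>(with_proj G \<restriction> X) \<restriction> Y\<^esub> v \<longleftrightarrow> (u, v) \<in> rtrancl_on Y (parcs G)"
    and "u \<rightarrow>\<^sup>*\<^bsub>with_proj G \<restriction> Y\<^esub> v \<longleftrightarrow> (u, v) \<in> rtrancl_on Y (parcs G)"
proof -
  have "arcs_ends ((with_proj G \<restriction> X) \<restriction> Y) = Restr (Restr (parcs G) X) Y"
    "arcs_ends (with_proj G \<restriction> Y) = Restr (parcs G) Y"
    by (auto simp: induce_subgraph_def arcs_ends_def arc_to_ends_def)
  then show "u \<rightarrow>\<^sup>*\<^bsub>(with_proj G \<restriction> X) \<restriction> Y\<^esub> v \<longleftrightarrow> (u, v) \<in> rtrancl_on Y (parcs G)"
    and "u \<rightarrow>\<^sup>*\<^bsub>with_proj G \<restriction> Y\<^esub> v \<longleftrightarrow> (u, v) \<in> rtrancl_on Y (parcs G)"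
    using assms by (simp_all add: reachable_def rtrancl_on_Restr)
qed

lemma connected_induce_iff:
  assumes "sym (parcs G)"
  shows "Digraph_Component.connected (with_proj G \<restriction> X) \<longleftrightarrow>
    X \<noteq> {} \<and> (\<forall>u\<in>X. \<forall>v\<in>X. (u, v) \<in> rtrancl_on X (parcs G))"
proof -
  have "parcs (mk_symmetric (with_proj G \<restriction> X)) = Restr (parcs G) X"
    using assms by (auto simp: mk_symmetric_def induce_subgraph_def dest: symD)
  moreover have "pverts (mk_symmetric (with_proj G \<restriction> X)) = X"
    by (simp add: mk_symmetric_def)
  ultimately show ?thesis
    by (simp add: Digraph_Component.connected_def strongly_connected_def reachable_def
        rtrancl_on_Restr)
qed

lemma connected_pair_graph_iff:
  assumes "pair_graph G"
  shows "Digraph_Component.connected (with_proj G) \<longleftrightarrow>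
    pverts G \<noteq> {} \<and> (\<forall>u\<in>pverts G. \<forall>v\<in>pverts G. (u, v) \<in> rtrancl_on (pverts G) (parcs G))"
proof -
  have "with_proj G \<restriction> pverts G = with_proj G"
    using assms by (auto simp: pair_graph_iff induce_subgraph_def with_proj_def)
  then show ?thesis
    using connected_induce_iff[of G "pverts G"] assms by (simp add: pair_graph_iff)
qed

lemma separates_iff:
  "separates G S u v \<longleftrightarrow> S \<subseteq> pverts G \<and> u \<in> pverts G - S \<and> v \<in> pverts G - S \<and>
     (u, v) \<notin> rtrancl_on (pverts G - S) (parcs G)"
  by (simp add: separates_def reachable_induce_iff(2)[OF order_refl])

lemma rtrancl_on_symD: "sym r \<Longrightarrow> (a, b) \<in> rtrancl_on F r \<Longrightarrow> (b, a) \<in> rtrancl_on F r"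
  by (meson rtrancl_on_sym symD)

lemma rtrancl_on_single: "(a, b) \<in> r \<Longrightarrow> a \<in> F \<Longrightarrow> b \<in> F \<Longrightarrow> (a, b) \<in> rtrancl_on F r"
  by (meson rtrancl_on_into_rtrancl_on rtrancl_on_refl)

lemma nonseparableI:
  assumes "sym (parcs G)" "X \<noteq> {}"
    and conn: "\<And>u v. u \<in> X \<Longrightarrow> v \<in> X \<Longrightarrow> (u, v) \<in> rtrancl_on X (parcs G)"
    and cut: "\<And>x u v. x \<in> X \<Longrightarrow> u \<in> X - {x} \<Longrightarrow> v \<in> X - {x} \<Longrightarrow>
      (u, v) \<in> rtrancl_on (X - {x}) (parcs G)"
  shows "nonseparable (with_proj G \<restriction> X)"
  unfolding nonseparable_def connected_induce_iff[OF assms(1)] cut_vertex_def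
  using assms by (auto simp: reachable_induce_iff(1)[of "X - {_}" X])

section \<open>Paths, and cycles in block graphs\<close>

lemma rtrancl_on_imp_path:
  assumes "(a, b) \<in> rtrancl_on F r"
  obtains p where "p \<noteq> []" "hd p = a" "last p = b" "set p \<subseteq> F" "distinct p"
    "successively (\<lambda>x y. (x, y) \<in> r) p"
proof -
  from assms have "\<exists>p. p \<noteq> [] \<and> hd p = a \<and> last p = b \<and> set p \<subseteq> F \<and> distinct p \<and>
    successively (\<lambda>x y. (x, y) \<in> r) p"
  proof (induction rule: rtrancl_on_induct)
    case base
    then show ?case by (intro exI[of _ "[a]"]) auto
  next
    case (step y z)
    then obtain p where p: "p \<noteq> []" "hd p = a" "last p = y" "set p \<subseteq> F" "distinct p"
      "successively (\<lambda>x y. (x, y) \<in> r) p" by blast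
    show ?case
    proof (cases "z \<in> set p")
      \<comment> \<open>If \<open>z\<close> already lies on the path, the prefix ending at
        \<open>z\<close> is taken instead, which keeps the vertices distinct.\<close>
      case True
      then obtain q t where "p = q @ z # t" by (meson split_list)
      with p have "p = (q @ [z]) @ t" by simp
      with p show ?thesis
        by (intro exI[of _ "q @ [z]"]) (auto simp: successively_append_iff hd_append split: if_splits)
    next
      case False
      with p step show ?thesis
        by (intro exI[of _ "p @ [z]"]) (auto simp: successively_append_iff)
    qed
  qed
  with that show ?thesis by blast
qed

lemma path_connected:
  assumes "successively (\<lambda>x y. (x, y) \<in> r) p" "p \<noteq> []" "u \<in> set p" "set p \<subseteq> F"
  shows "(hd p, u) \<in> rtrancl_on F r" "(u, last p) \<in> rtrancl_on F r"
proof -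
  show "(hd p, u) \<in> rtrancl_on F r"
    using assms
  proof (induction p)
    case (Cons a p)
    show ?case
    proof (cases "u = a \<or> p = []")
      case False
      with Cons have "(a, hd p) \<in> r" "(hd p, u) \<in> rtrancl_on F r"
        by (auto simp: successively_Cons)
      then show ?thesis using Cons.prems
        by (auto intro: converse_rtrancl_on_into_rtrancl_on)
    qed (use Cons.prems in auto)
  qed simp
  show "(u, last p) \<in> rtrancl_on F r"
    using assms
  proof (induction p rule: rev_induct)
    case (snoc a p)
    show ?case
    proof (cases "u = a \<or> p = []")
      case False
      with snoc have "(last p, a) \<in> r" "(u, last p) \<in> rtrancl_on F r"
        by (auto simp: successively_append_iff)
      then show ?thesis using snoc.prems
        by (auto intro: rtrancl_on_into_rtrancl_on)
    qed (use snoc.prems in auto)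
  qed simp
qed

text \<open>A path in \<open>G - x\<close> between two neighbours of \<open>x\<close> closes up to a cycle through \<open>x\<close>,
  which lies in one block.\<close>

lemma block_graph_neighbours_adjacent:
  assumes G: "block_graph G" and xa: "(x, a) \<in> parcs G" and xb: "(x, b) \<in> parcs G"
    and ab: "a \<noteq> b" and reach: "(a, b) \<in> rtrancl_on (pverts G - {x}) (parcs G)"
  shows "(a, b) \<in> parcs G"
proof -
  have pg: "pair_graph G" and blocks: "\<And>B. block G B \<Longrightarrow> clique G B"
    using G by (auto simp: block_graph_def)
  have fin: "finite (pverts G)" and arcs: "parcs G \<subseteq> pverts G \<times> pverts G"
    and sym: "sym (parcs G)"
    using pg by (auto simp: pair_graph_iff)
  obtain p where p: "p \<noteq> []" "hd p = a" "last p = b" "set p \<subseteq> pverts G - {x}" "distinct p"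
    "successively (\<lambda>x y. (x, y) \<in> parcs G) p"
    using rtrancl_on_imp_path[OF reach] .
  define Z where "Z = insert x (set p)"
  \<comment> \<open>By symmetry, a set is connected as soon as one vertex \<open>c\<close> reaches
    all of it.\<close>
  have centre: "(u, v) \<in> rtrancl_on F (parcs G)"
    if "\<And>u. u \<in> F \<Longrightarrow> (c, u) \<in> rtrancl_on F (parcs G)" "u \<in> F" "v \<in> F" for c u v F
    using that by (meson rtrancl_on_symD rtrancl_on_trans sym)
  have "nonseparable (with_proj G \<restriction> Z)"
  proof (rule nonseparableI[OF sym])
    show "(u, v) \<in> rtrancl_on Z (parcs G)" if "u \<in> Z" "v \<in> Z" for u v
    proof (rule centre[OF _ that])
      fix y assume y: "y \<in> Z"
      show "(x, y) \<in> rtrancl_on Z (parcs G)"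
      proof (cases "y = x")
        case False
        then have "(a, y) \<in> rtrancl_on Z (parcs G)"
          using path_connected(1)[OF p(6,1), of y Z] y p(2) by (auto simp: Z_def)
        then show ?thesis
          using xa by (auto simp: Z_def intro: converse_rtrancl_on_into_rtrancl_on)
      qed (auto simp: Z_def)
    qed
    show "(u, v) \<in> rtrancl_on (Z - {c}) (parcs G)"
      if c: "c \<in> Z" and uv: "u \<in> Z - {c}" "v \<in> Z - {c}" for c u v
    proof (cases "c = x")
      case True
      then have Zc: "Z - {c} = set p" using p(4) by (auto simp: Z_def)
      show ?thesis
        unfolding Zc
        by (rule centre[of _ a]) (use path_connected(1)[OF p(6,1)] p(2) uv Zc in auto)
    next
      case False
      then have "c \<in> set p" using c by (auto simp: Z_def)
      \<comment> \<open>Deleting a path vertex \<open>c\<close> opens the cycle: \<open>q\<close>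
        still hangs on \<open>x\<close> through \<open>a\<close>, and \<open>t\<close> through
        \<open>b\<close>.\<close>
      then obtain q t where qt: "p = q @ c # t" by (meson split_list)
      have succ: "successively (\<lambda>x y. (x, y) \<in> parcs G) q"
        "successively (\<lambda>x y. (x, y) \<in> parcs G) t"
        using p(6) by (auto simp: qt successively_append_iff successively_Cons)
      have Zc: "Z - {c} = insert x (set q \<union> set t)"
        using p(5) False by (auto simp: Z_def qt)
      show ?thesis
      proof (rule centre[OF _ uv])
        fix y assume "y \<in> Z - {c}"
        then consider "y = x" | "y \<in> set q" | "y \<in> set t" by (auto simp: Zc)
        then show "(x, y) \<in> rtrancl_on (Z - {c}) (parcs G)"
        proof cases
          case 1
          then show ?thesis by (auto simp: Zc)
        next
          case 2
          then have "(a, y) \<in> rtrancl_on (Z - {c}) (parcs G)"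
            using path_connected(1)[OF succ(1), of y "Z - {c}"] p(2)
            by (cases q) (auto simp: Zc qt)
          then show ?thesis
            using xa by (auto simp: Zc intro: converse_rtrancl_on_into_rtrancl_on)
        next
          case 3
          then have "(y, b) \<in> rtrancl_on (Z - {c}) (parcs G)"
            using path_connected(2)[OF succ(2), of y "Z - {c}"] p(3)
            by (cases t) (auto simp: Zc qt)
          then have "(b, y) \<in> rtrancl_on (Z - {c}) (parcs G)"
            by (rule rtrancl_on_symD[OF sym])
          then show ?thesis
            using xb by (auto simp: Zc intro: converse_rtrancl_on_into_rtrancl_on)
        qed
      qed
    qed
  qed (auto simp: Z_def)
  moreover have "Z \<subseteq> pverts G"
    using p(4) xa arcs by (auto simp: Z_def)
  ultimately have "Z \<in> {C. C \<subseteq> pverts G \<and> nonseparable (with_proj G \<restriction> C)}" by simp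
  \<comment> \<open>A maximal nonseparable set above the cycle is a block, hence a clique, and it
    contains \<open>a\<close> and \<open>b\<close>.\<close>
  from finite_has_maximal2[OF _ this] obtain B where B: "Z \<subseteq> B" "B \<subseteq> pverts G"
      "nonseparable (with_proj G \<restriction> B)"
      "\<forall>C. C \<subseteq> pverts G \<and> nonseparable (with_proj G \<restriction> C) \<longrightarrow> B \<subseteq> C \<longrightarrow> B = C"
    using fin by auto
  then have "block G B"
    unfolding block_def by (metis psubset_eq)
  moreover have "a \<in> Z" "b \<in> Z" using p(1-3) by (auto simp: Z_def)
  ultimately show ?thesis
    using blocks[of B] ab B(1) by (auto simp: clique_def)
qed

section \<open>Twin classes and their separation property\<close>

definition closed_nbhd :: "'a pair_pre_digraph \<Rightarrow> 'a \<Rightarrow> 'a set" where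
  "closed_nbhd G v = insert v (nbhd G v)"

definition twins :: "'a pair_pre_digraph \<Rightarrow> 'a \<Rightarrow> 'a set" where
  "twins G x = {z. closed_nbhd G z = closed_nbhd G x}"

text \<open>The whole twin class has to be removed: any remaining twin of \<open>x\<close> would be
  adjacent to both \<open>a\<close> and \<open>b\<close>. This form survives the addition of true
  twins.\<close>

definition twins_separate :: "'a pair_pre_digraph \<Rightarrow> bool" where
  "twins_separate G \<longleftrightarrow> (\<forall>x a b. (x, a) \<in> parcs G \<longrightarrow> (x, b) \<in> parcs G \<longrightarrow> a \<noteq> b \<longrightarrow>
     (a, b) \<notin> parcs G \<longrightarrow> (a, b) \<notin> rtrancl_on (pverts G - twins G x) (parcs G))"

lemma self_in_twins: "x \<in> twins G x"
  by (simp add: twins_def)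

lemma closed_nbhd_iff: "y \<in> closed_nbhd G x \<longleftrightarrow> y = x \<or> (x, y) \<in> parcs G"
  by (simp add: closed_nbhd_def nbhd_def)

text \<open>Induction over the construction. In a block graph already the removal of
  \<open>x\<close> alone separates non-adjacent neighbours of \<open>x\<close>. For an added twin,
  folding \<open>w\<close> onto \<open>v\<close> carries a walk of the new graph that avoids a twin
  class to a walk of \<open>G\<close> that avoids the corresponding class.\<close>

lemma strictly_chordal_twins_separate:
  assumes "strictly_chordal G"
  shows "pair_graph G \<and> Digraph_Component.connected (with_proj G) \<and> twins_separate G"
  using assms
proof induction
  case (block_graph G)
  have adj: "(a, b) \<in> parcs G" if "(x, a) \<in> parcs G" "(x, b) \<in> parcs G" "a \<noteq> b"
    "(a, b) \<in> rtrancl_on (pverts G - twins G x) (parcs G)" for x a b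
  proof (rule block_graph_neighbours_adjacent[OF block_graph that(1-3)])
    show "(a, b) \<in> rtrancl_on (pverts G - {x}) (parcs G)"
      by (rule rtrancl_on_mono[OF order_refl _ that(4)]) (use self_in_twins[of x G] in auto)
  qed
  then have "twins_separate G"
    unfolding twins_separate_def by blast
  moreover have "pair_graph G" "Digraph_Component.connected (with_proj G)"
    using block_graph by (simp_all add: block_graph_def)
  ultimately show ?case by blast
next
  case (true_twin G v w)
  let ?H = "add_true_twin G v w"
  define \<pi> where "\<pi> y = (if y = w then v else y)" for y
  have pg: "pair_graph G" and conn: "Digraph_Component.connected (with_proj G)"
    and sep: "twins_separate G"
    using true_twin.IH by auto
  have fin: "finite (pverts G)" and arcs: "parcs G \<subseteq> pverts G \<times> pverts G"
    and sym: "sym (parcs G)" and irr: "\<And>x. (x, x) \<notin> parcs G"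
    using pg by (auto simp: pair_graph_iff)
  have V: "pverts ?H = insert w (pverts G)"
    and E: "parcs ?H = parcs G \<union> {w} \<times> closed_nbhd G v \<union> closed_nbhd G v \<times> {w}"
    by (auto simp: add_true_twin_def closed_nbhd_def)
  have w: "w \<notin> pverts G" and v: "v \<in> pverts G" by fact+
  have wE: "(w, y) \<notin> parcs G" "(y, w) \<notin> parcs G" for y using arcs w by auto
  have cn_sub: "closed_nbhd G v \<subseteq> pverts G"
    using arcs v by (auto simp: closed_nbhd_iff)
  have "(z, y) \<in> parcs ?H" if "(y, z) \<in> parcs ?H" for y z
    using that symD[OF sym, of y z] by (auto simp: E)
  then have symH: "sym (parcs ?H)" by (rule symI)
  have "parcs ?H \<subseteq> pverts ?H \<times> pverts ?H"
    using arcs cn_sub by (auto simp: V E)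
  moreover have "(y, y) \<notin> parcs ?H" for y
    using irr[of y] cn_sub w by (auto simp: E)
  ultimately have pgH: "pair_graph ?H"
    using fin symH by (simp add: pair_graph_iff V)
  have subH: "(y, z) \<in> rtrancl_on (pverts ?H) (parcs ?H)"
    if "(y, z) \<in> rtrancl_on (pverts G) (parcs G)" for y z
    by (rule rtrancl_on_mono[OF _ _ that]) (auto simp: V E)
  have from_v: "(v, y) \<in> rtrancl_on (pverts ?H) (parcs ?H)" if "y \<in> pverts ?H" for y
  proof (cases "y = w")
    case True
    then show ?thesis using v by (intro rtrancl_on_single) (auto simp: V E closed_nbhd_iff)
  next
    case False
    then show ?thesis
      using conn that v by (intro subH) (auto simp: connected_pair_graph_iff[OF pg] V)
  qed
  have connH: "Digraph_Component.connected (with_proj ?H)"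
    unfolding connected_pair_graph_iff[OF pgH]
    using from_v v by (auto simp: V intro: rtrancl_on_trans[OF rtrancl_on_symD[OF symH]])
  \<comment> \<open>Closed neighbourhoods are needed on the right because the adjacent vertices
    \<open>v\<close> and \<open>w\<close> have the same image.\<close>
  have adj: "(y, z) \<in> parcs ?H \<longleftrightarrow> \<pi> z \<in> closed_nbhd G (\<pi> y)"
    if "y \<in> pverts ?H" "z \<in> pverts ?H" "y \<noteq> z" for y z
    using that wE symD[OF sym, of y v] symD[OF sym, of v y]
    by (auto simp: V E \<pi>_def closed_nbhd_iff)
  have \<pi>V: "\<pi> y \<in> pverts G" if "y \<in> pverts ?H" for y
    using that v by (auto simp: V \<pi>_def)
  \<comment> \<open>Closed neighbourhoods of the new graph are preimages under \<open>\<pi>\<close>.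
    Hence a vertex outside the twin class of \<open>x\<close> is mapped outside the twin class of
    \<open>\<pi> x\<close>.\<close>
  have cnH: "closed_nbhd ?H y = {z \<in> pverts ?H. \<pi> z \<in> closed_nbhd G (\<pi> y)}"
    if "y \<in> pverts ?H" for y
  proof (rule Set.set_eqI)
    fix z
    show "z \<in> closed_nbhd ?H y \<longleftrightarrow> z \<in> {z \<in> pverts ?H. \<pi> z \<in> closed_nbhd G (\<pi> y)}"
    proof (cases "z = y")
      case False
      then show ?thesis
        using adj[of y z] that pgH by (auto simp: closed_nbhd_iff[of _ ?H] pair_graph_iff)
    qed (use that in \<open>auto simp: closed_nbhd_iff\<close>)
  qed
  have reach: "(\<pi> a, \<pi> b) \<in> rtrancl_on (pverts G - twins G (\<pi> x)) (parcs G)"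
    if "(a, b) \<in> rtrancl_on (pverts ?H - twins ?H x) (parcs ?H)" "x \<in> pverts ?H" for a b x
  proof -
    have dom: "\<pi> y \<in> pverts G - twins G (\<pi> x)" if "y \<in> pverts ?H - twins ?H x" for y
      using that \<pi>V cnH[of y] cnH[OF \<open>x \<in> pverts ?H\<close>] by (auto simp: twins_def)
    from that(1) show ?thesis
    proof (induction rule: rtrancl_on_induct)
      case base
      then show ?case using dom by auto
    next
      case (step y z)
      show ?case
      proof (cases "y = z")
        case False
        \<comment> \<open>An arc of the new graph either collapses to a point or becomes an arc of
          \<open>G\<close>.\<close>
        then have "\<pi> z = \<pi> y \<or> (\<pi> y, \<pi> z) \<in> parcs G"
          using adj[of y z] step by (auto simp: closed_nbhd_iff)
        then show ?thesis
          using step dom by (metis rtrancl_on_into_rtrancl_on)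
      qed (use step in simp)
    qed
  qed
  have "twins_separate ?H"
    unfolding twins_separate_def
  proof (intro allI impI notI)
    fix x a b
    assume xa: "(x, a) \<in> parcs ?H" and xb: "(x, b) \<in> parcs ?H" and ab: "a \<noteq> b" "(a, b) \<notin> parcs ?H"
      and r: "(a, b) \<in> rtrancl_on (pverts ?H - twins ?H x) (parcs ?H)"
    have inV: "x \<in> pverts ?H" "a \<in> pverts ?H" "b \<in> pverts ?H" "x \<noteq> a" "x \<noteq> b"
      using xa xb pgH by (auto simp: pair_graph_iff)
    have cx: "\<pi> a \<in> closed_nbhd G (\<pi> x)" "\<pi> b \<in> closed_nbhd G (\<pi> x)"
      using adj[of x a] adj[of x b] inV xa xb by auto
    have cab: "\<pi> b \<notin> closed_nbhd G (\<pi> a)" "\<pi> a \<notin> closed_nbhd G (\<pi> b)"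
      using adj[of a b] adj[of b a] inV ab symD[OF symH, of b a] by auto
    \<comment> \<open>Neither arc at \<open>x\<close> collapses: if
      \<open>\<pi> a = \<pi> x\<close>, then \<open>\<pi> b\<close> would lie in the closed
      neighbourhood of \<open>\<pi> a\<close>, and likewise with \<open>a\<close> and
      \<open>b\<close> exchanged.\<close>
    have "(\<pi> x, \<pi> a) \<in> parcs G" "(\<pi> x, \<pi> b) \<in> parcs G"
      using cx cab by (auto simp: closed_nbhd_iff)
    moreover have "\<pi> a \<noteq> \<pi> b" "(\<pi> a, \<pi> b) \<notin> parcs G"
      using cab by (auto simp: closed_nbhd_iff)
    ultimately show False
      using sep reach[OF r inV(1)] by (auto simp: twins_separate_def)
  qed
  with pgH connH show ?case by blast
qed


section \<open>Minimal vertex separators are twin classes\<close>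

lemma mvs_full:
  assumes uv: "u \<in> pverts G - S" and min: "\<And>T. T \<subset> S \<Longrightarrow> \<not> separates G T u v"
    and sep: "separates G S u v" and x: "x \<in> S"
  shows "\<exists>a. (a, x) \<in> parcs G \<and> (u, a) \<in> rtrancl_on (pverts G - S) (parcs G)"
proof (rule ccontr)
  \<comment> \<open>If no neighbour of \<open>x\<close> lies in the component of \<open>u\<close>,
    putting \<open>x\<close> back does not enlarge that component. But by minimality
    \<open>S - {x}\<close> no longer separates \<open>u\<close> from \<open>v\<close>.\<close>
  assume none: "\<not> ?thesis"
  let ?T = "S - {x}"
  have "\<not> separates G ?T u v" using min x by blast
  then have "(u, v) \<in> rtrancl_on (pverts G - ?T) (parcs G)"
    using sep by (auto simp: separates_iff)
  then have "(u, v) \<in> rtrancl_on (pverts G - S) (parcs G)"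
  proof (induction rule: rtrancl_on_induct)
    case base
    then show ?case using uv by auto
  next
    case (step y z)
    with none have "z \<noteq> x" by blast
    with step show ?case by (auto intro: rtrancl_on_into_rtrancl_on)
  qed
  with sep show False by (simp add: separates_iff)
qed

lemma separates_commute:
  assumes "sym (parcs G)"
  shows "separates G S u v \<longleftrightarrow> separates G S v u"
  using rtrancl_on_symD[OF assms] by (auto simp: separates_iff)

lemma mvsE:
  assumes pg: "pair_graph G" and S: "minimal_vertex_separator G S"
  obtains u v where "(u, v) \<notin> rtrancl_on (pverts G - S) (parcs G)"
    "\<And>x. x \<in> S \<Longrightarrow> \<exists>a. (x, a) \<in> parcs G \<and> (u, a) \<in> rtrancl_on (pverts G - S) (parcs G)"
    "\<And>x. x \<in> S \<Longrightarrow> \<exists>b. (x, b) \<in> parcs G \<and> (v, b) \<in> rtrancl_on (pverts G - S) (parcs G)"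
proof -
  have sym: "sym (parcs G)" using pg by (simp add: pair_graph_iff)
  obtain u v where sep: "separates G S u v" and min: "\<And>T. T \<subset> S \<Longrightarrow> \<not> separates G T u v"
    using S by (auto simp: minimal_vertex_separator_def)
  have sep': "separates G S v u" and min': "\<And>T. T \<subset> S \<Longrightarrow> \<not> separates G T v u"
    using sep min separates_commute[OF sym] by auto
  have uv: "u \<in> pverts G - S" "v \<in> pverts G - S"
    using sep by (auto simp: separates_iff)
  show thesis
  proof (rule that[of u v])
    show "(u, v) \<notin> rtrancl_on (pverts G - S) (parcs G)"
      using sep by (simp add: separates_iff)
    show "\<exists>a. (x, a) \<in> parcs G \<and> (u, a) \<in> rtrancl_on (pverts G - S) (parcs G)" if "x \<in> S" for x
      using mvs_full[OF uv(1) min sep that] symD[OF sym] by blast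
    show "\<exists>b. (x, b) \<in> parcs G \<and> (v, b) \<in> rtrancl_on (pverts G - S) (parcs G)" if "x \<in> S" for x
      using mvs_full[OF uv(2) min' sep' that] symD[OF sym] by blast
  qed
qed

lemma mvs_subset: "minimal_vertex_separator G S \<Longrightarrow> S \<subseteq> pverts G"
  by (auto simp: minimal_vertex_separator_def separates_iff)

text \<open>By \<open>mvsE\<close>, a vertex of \<open>S\<close> has neighbours in two different
  components of \<open>G - S\<close>; if its neighbourhood were a clique, they would be equal or
  adjacent.\<close>

lemma mvs_not_simplicial:
  assumes pg: "pair_graph G" and S: "minimal_vertex_separator G S" and x: "x \<in> S"
  shows "\<not> simplicial G x"
proof
  assume simp: "simplicial G x"
  have sym: "sym (parcs G)" using pg by (simp add: pair_graph_iff)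
  obtain u v a b where uv: "(u, v) \<notin> rtrancl_on (pverts G - S) (parcs G)"
    and a: "(x, a) \<in> parcs G" "(u, a) \<in> rtrancl_on (pverts G - S) (parcs G)"
    and b: "(x, b) \<in> parcs G" "(v, b) \<in> rtrancl_on (pverts G - S) (parcs G)"
    using mvsE[OF pg S] x by metis
  have "a = b \<or> (a, b) \<in> parcs G"
    using simp a(1) b(1) by (auto simp: simplicial_def clique_def nbhd_def)
  then have "(u, b) \<in> rtrancl_on (pverts G - S) (parcs G)"
    using a(2) in_rtrancl_on_in_F(2)[OF b(2)] by (auto intro: rtrancl_on_into_rtrancl_on)
  with b(2) uv show False
    by (meson rtrancl_on_symD rtrancl_on_trans sym)
qed

text \<open>Some two neighbours \<open>a\<close> and \<open>b\<close> of \<open>x\<close> are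
  non-adjacent, and every set separating them contains \<open>x\<close>. Removing all vertices but
  \<open>a\<close> and \<open>b\<close> separates them, so by finiteness an inclusion-minimal
  separator exists.\<close>

lemma not_simplicial_in_mvs:
  assumes pg: "pair_graph G" and x: "x \<in> pverts G" and ns: "\<not> simplicial G x"
  obtains S where "minimal_vertex_separator G S" "x \<in> S"
proof -
  have fin: "finite (pverts G)" and arcs: "parcs G \<subseteq> pverts G \<times> pverts G"
    and sym: "sym (parcs G)" and irr: "\<And>x. (x, x) \<notin> parcs G"
    using pg by (auto simp: pair_graph_iff)
  obtain a b where ab: "(x, a) \<in> parcs G" "(x, b) \<in> parcs G" "a \<noteq> b" "(a, b) \<notin> parcs G"
    using ns x arcs by (auto simp: simplicial_def clique_def nbhd_def)
  have V: "a \<in> pverts G" "b \<in> pverts G" using ab arcs by auto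
  let ?A = "{S. S \<subseteq> pverts G \<and> separates G S a b}"
  have "(a, z) \<in> rtrancl_on {a, b} (parcs G) \<Longrightarrow> z = a" for z
    by (induction rule: rtrancl_on_induct) (use ab in auto)
  then have "(a, b) \<notin> rtrancl_on {a, b} (parcs G)" using ab by blast
  moreover have "pverts G - (pverts G - {a, b}) = {a, b}" using V by auto
  ultimately have "pverts G - {a, b} \<in> ?A"
    using V by (simp add: separates_iff)
  from finite_has_minimal2[OF _ this] obtain S where S: "S \<in> ?A"
    and min: "\<forall>T\<in>?A. T \<subseteq> S \<longrightarrow> S = T"
    using fin by auto
  have "\<not> separates G T a b" if "T \<subset> S" for T
    using min that by (auto simp: separates_iff)
  then have "minimal_vertex_separator G S"
    unfolding minimal_vertex_separator_def using S V ab by blast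
  moreover have "x \<in> S"
  proof (rule ccontr)
    assume "x \<notin> S"
    then have "(a, x) \<in> rtrancl_on (pverts G - S) (parcs G)"
      using S ab x symD[OF sym] by (intro rtrancl_on_single) (auto simp: separates_iff)
    then have "(a, b) \<in> rtrancl_on (pverts G - S) (parcs G)"
      using S ab by (auto simp: separates_iff intro: rtrancl_on_into_rtrancl_on)
    with S show False by (simp add: separates_iff)
  qed
  ultimately show thesis by (rule that)
qed

text \<open>Let \<open>a\<close> and \<open>b\<close> be neighbours of \<open>x\<close> on the two
  sides of \<open>S\<close>. A twin of \<open>x\<close> outside \<open>S\<close> would join the two
  sides, so the twin class lies in \<open>S\<close>. Conversely, a vertex \<open>y\<close> of
  \<open>S\<close> that is no twin of \<open>x\<close> also has neighbours on both sides, and the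
  route from \<open>a\<close> through \<open>y\<close> to \<open>b\<close> avoids the twin class,
  against \<open>twins_separate\<close>.\<close>

lemma mvs_eq_twins:
  assumes pg: "pair_graph G" and ts: "twins_separate G"
    and S: "minimal_vertex_separator G S" and x: "x \<in> S"
  shows "S = twins G x"
proof -
  let ?r = "\<lambda>a b. (a, b) \<in> rtrancl_on (pverts G - S) (parcs G)"
  have sym: "sym (parcs G)" using pg by (simp add: pair_graph_iff)
  obtain u v where uv: "\<not> ?r u v"
    and ex_u: "\<And>x. x \<in> S \<Longrightarrow> \<exists>a. (x, a) \<in> parcs G \<and> ?r u a"
    and ex_v: "\<And>x. x \<in> S \<Longrightarrow> \<exists>b. (x, b) \<in> parcs G \<and> ?r v b"
    by (rule mvsE[OF pg S]) (rule that; blast)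
  obtain a b where a: "(x, a) \<in> parcs G" "?r u a" and b: "(x, b) \<in> parcs G" "?r v b"
    using ex_u[OF x] ex_v[OF x] by blast
  have no: "\<not> (?r u z \<and> ?r v z)" for z
    using uv by (meson rtrancl_on_symD rtrancl_on_trans sym)
  have sub: "twins G x \<subseteq> S"
  proof (rule ccontr)
    assume "\<not> twins G x \<subseteq> S"
    then obtain z where z: "closed_nbhd G z = closed_nbhd G x" "z \<notin> S"
      by (auto simp: twins_def)
    then have "z = a \<or> (z, a) \<in> parcs G" "z = b \<or> (z, b) \<in> parcs G"
      using a(1) b(1) by (metis closed_nbhd_iff)+
    moreover have "z \<in> pverts G"
      using calculation pg a(1) by (auto simp: pair_graph_iff)
    ultimately have "?r u z" "?r v z"
      using a(2) b(2) z(2) symD[OF sym, of z] by (auto intro: rtrancl_on_into_rtrancl_on)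
    with no show False by blast
  qed
  moreover have "y \<in> twins G x" if y: "y \<in> S" for y
  proof (rule ccontr)
    assume ny: "y \<notin> twins G x"
    obtain a' b' where a': "(y, a') \<in> parcs G" "?r u a'" and b': "(y, b') \<in> parcs G" "?r v b'"
      using ex_u[OF y] ex_v[OF y] by blast
    let ?q = "\<lambda>a b. (a, b) \<in> rtrancl_on (pverts G - twins G x) (parcs G)"
    \<comment> \<open>The twin class lies in \<open>S\<close>, so its removal deletes no more than
      the removal of \<open>S\<close>.\<close>
    have mono: "?q c d" if "?r c d" for c d
      by (rule rtrancl_on_mono[OF order_refl _ that]) (use sub in auto)
    have "?q a a'" "?q b' b"
      using a(2) a'(2) b(2) b'(2) by (meson mono rtrancl_on_symD rtrancl_on_trans sym)+
    moreover have "?q a' y"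
      using a'(1) ny mvs_subset[OF S] y in_rtrancl_on_in_F(2)[OF calculation(1)] symD[OF sym]
      by (intro rtrancl_on_single) auto
    moreover have "?q y b'"
      using b'(1) ny mvs_subset[OF S] y in_rtrancl_on_in_F(1)[OF calculation(2)]
      by (intro rtrancl_on_single) auto
    ultimately have "?q a b" by (meson rtrancl_on_trans)
    moreover have "a \<noteq> b" using no a(2) b(2) by blast
    moreover have "(a, b) \<notin> parcs G"
      using no a(2) b(2) in_rtrancl_on_in_F(2)[OF b(2)]
      by (meson rtrancl_on_into_rtrancl_on)
    ultimately show False
      using ts a(1) b(1) by (auto simp: twins_separate_def)
  qed
  ultimately show ?thesis by blast
qed

section \<open>Structure of the core graphs\<close>

locale si_core =
  fixes G :: "'a pair_pre_digraph" and S1 S2 P1 P2 :: "'a set" and s p :: nat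
  assumes pair_graph: "pair_graph G"
    and verts: "pverts G = S1 \<union> S2 \<union> P1 \<union> P2"
    and disjoint: "S1 \<inter> S2 = {}" "(S1 \<union> S2) \<inter> (P1 \<union> P2) = {}" "P1 \<inter> P2 = {}"
    and card: "card S1 = s" "card S2 = s" "card P1 = p" "card P2 = p"
    and nbhd_S1: "\<And>x. x \<in> S1 \<Longrightarrow> nbhd G x = S1 \<union> S2 \<union> P1 - {x}"
    and nbhd_S2: "\<And>x. x \<in> S2 \<Longrightarrow> nbhd G x = S1 \<union> S2 \<union> P2 - {x}"
    and nbhd_P1: "\<And>x. x \<in> P1 \<Longrightarrow> S1 \<subseteq> nbhd G x \<and> nbhd G x \<subseteq> S1 \<union> P1"
    and nbhd_P2: "\<And>x. x \<in> P2 \<Longrightarrow> S2 \<subseteq> nbhd G x \<and> nbhd G x \<subseteq> S2 \<union> P2"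
    and clique_nbhd: "\<And>x. x \<in> P1 \<union> P2 \<Longrightarrow> clique G (nbhd G x)"

text \<open>Each separator is a full twin class, so an outside vertex sees all of it or none of it.
  The vertices in no separator are exactly the simplicial ones. Connectedness makes each of them see
  \<open>S1\<close> or \<open>S2\<close>, and maximality of the clique \<open>S1 \<union> S2\<close>
  excludes both.\<close>

lemma SI_core_imp_si_core:
  assumes si: "SI_core s p G" and s: "s > 0"
  obtains S1 S2 where "si_core G S1 S2 (simplicial_at G S1) (simplicial_at G S2) s p"
proof -
  obtain S1 S2 where ne: "S1 \<noteq> S2" and mvs: "{S. minimal_vertex_separator G S} = {S1, S2}"
    and cards: "card S1 = s" "card S2 = s" and max: "maximal_clique G (S1 \<union> S2)"
    and cardp: "card (simplicial_at G S1) = p" "card (simplicial_at G S2) = p"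
    and "strictly_interval G"
    using si by (auto simp: SI_core_def)
  then have pg: "pair_graph G" and conn: "Digraph_Component.connected (with_proj G)"
    and ts: "twins_separate G"
    using strictly_chordal_twins_separate by (auto simp: strictly_interval_def)
  have fin: "finite (pverts G)" and arcs: "parcs G \<subseteq> pverts G \<times> pverts G"
    and sym: "sym (parcs G)" and irr: "\<And>x. (x, x) \<notin> parcs G"
    using pg by (auto simp: pair_graph_iff)
  have comm: "(x, y) \<in> parcs G \<longleftrightarrow> (y, x) \<in> parcs G" for x y
    using symD[OF sym] by blast
  have m: "minimal_vertex_separator G S1" "minimal_vertex_separator G S2"
    and m_only: "\<And>S. minimal_vertex_separator G S \<Longrightarrow> S = S1 \<or> S = S2"
    using mvs by auto
  have sub: "S1 \<subseteq> pverts G" "S2 \<subseteq> pverts G" using m mvs_subset by auto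
  have tw: "S = twins G x" if "S = S1 \<or> S = S2" "x \<in> S" for S x
    using mvs_eq_twins[OF pg ts] m that by blast
  have disj: "S1 \<inter> S2 = {}" using tw ne by blast
  let ?Q = "S1 \<union> S2"
  have Q: "(x, y) \<in> parcs G" if "x \<in> ?Q" "y \<in> ?Q" "x \<noteq> y" for x y
    using max that by (auto simp: maximal_clique_def clique_def)
  have simp_iff: "simplicial G x \<longleftrightarrow> x \<notin> ?Q" if "x \<in> pverts G" for x
    using not_simplicial_in_mvs[OF pg that] mvs_not_simplicial[OF pg] m m_only by blast
  have simpD: "y = z \<or> (y, z) \<in> parcs G"
    if "x \<in> pverts G" "x \<notin> ?Q" "(x, y) \<in> parcs G" "(x, z) \<in> parcs G" for x y z
    using simp_iff[of x] that by (auto simp: simplicial_def clique_def nbhd_def)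
  have adj_all: "(y, x) \<in> parcs G"
    if "S = S1 \<or> S = S2" "x \<in> S" "q \<in> S" "y \<notin> S" "(y, q) \<in> parcs G" for S x y q
  proof -
    have "x \<in> twins G q" using tw[OF that(1,3)] that(2) by blast
    then have "y \<in> closed_nbhd G x"
      using that comm by (auto simp: twins_def closed_nbhd_iff)
    then show ?thesis using that comm by (auto simp: closed_nbhd_iff)
  qed
  \<comment> \<open>Such a \<open>y\<close> would extend the clique; if \<open>y\<close> belongs to
    it already, \<open>y\<close> would be its own neighbour.\<close>
  have not_both: "\<not> (S1 \<subseteq> nbhd G y \<and> S2 \<subseteq> nbhd G y)" if "y \<in> pverts G" for y
  proof
    assume "S1 \<subseteq> nbhd G y \<and> S2 \<subseteq> nbhd G y"
    then have adj: "(y, q) \<in> parcs G" "(q, y) \<in> parcs G" if "q \<in> ?Q" for q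
      using that comm[of q y] by (auto simp: nbhd_def)
    then have "clique G (insert y ?Q)"
      using \<open>y \<in> pverts G\<close> sub Q unfolding clique_def by blast
    then have "insert y ?Q = ?Q"
      using max unfolding maximal_clique_def by blast
    then have "y \<in> ?Q" by blast
    then show False using adj irr by blast
  qed
  let ?P1 = "simplicial_at G S1" and ?P2 = "simplicial_at G S2"
  have P1: "y \<in> ?P1 \<longleftrightarrow> y \<in> pverts G \<and> y \<notin> ?Q \<and> S1 \<subseteq> nbhd G y" for y
    using simp_iff by (auto simp: simplicial_at_def)
  have P2: "y \<in> ?P2 \<longleftrightarrow> y \<in> pverts G \<and> y \<notin> ?Q \<and> S2 \<subseteq> nbhd G y" for y
    using simp_iff by (auto simp: simplicial_at_def)
  obtain q0 where q0: "q0 \<in> S1" using cards s by (metis card_gt_0_iff ex_in_conv)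
  have near: "y \<in> ?Q \<or> (\<exists>q\<in>?Q. (y, q) \<in> parcs G)" if "y \<in> pverts G" for y
  proof -
    have "(q0, y) \<in> rtrancl_on (pverts G) (parcs G)"
      using conn that q0 sub by (auto simp: connected_pair_graph_iff[OF pg])
    then show ?thesis
    proof (induction rule: rtrancl_on_induct)
      case base
      then show ?case using q0 by blast
    next
      \<comment> \<open>If \<open>y\<close> is outside the clique it is simplicial and has a
        neighbour \<open>q\<close> in the clique; \<open>z\<close> and \<open>q\<close>, both
        neighbours of \<open>y\<close>, are then equal or adjacent.\<close>
      case (step y z)
      then show ?case using simpD[of y z] comm by blast
    qed
  qed
  have cover: "y \<in> ?P1 \<or> y \<in> ?P2" if y: "y \<in> pverts G" "y \<notin> ?Q" for y
  proof -
    obtain q where "q \<in> ?Q" "(y, q) \<in> parcs G" using near y by blast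
    then show ?thesis
      using adj_all[of S1 _ q y] adj_all[of S2 _ q y] y by (auto simp: P1 P2 nbhd_def)
  qed
  \<comment> \<open>The neighbourhood of the simplicial \<open>y\<close> contains \<open>S1\<close>
    and \<open>z\<close>, so \<open>z\<close> would see \<open>S1\<close> as well as
    \<open>S2\<close>.\<close>
  have PP: "(y, z) \<notin> parcs G" if "y \<in> ?P1" "z \<in> ?P2" for y z
  proof
    assume yz: "(y, z) \<in> parcs G"
    have "S1 \<subseteq> nbhd G z"
    proof
      fix x assume x: "x \<in> S1"
      then have "(y, x) \<in> parcs G" using that by (auto simp: P1 nbhd_def)
      then show "x \<in> nbhd G z"
        using simpD[of y x z] that yz x comm by (auto simp: P1 P2 nbhd_def)
    qed
    then show False using not_both[of z] that by (auto simp: P2)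
  qed
  have P1_S2: "(y, q) \<notin> parcs G" if "y \<in> ?P1" "q \<in> S2" for y q
    using adj_all[of S2 _ q y] not_both[of y] that by (auto simp: P1 nbhd_def)
  have P2_S1: "(y, q) \<notin> parcs G" if "y \<in> ?P2" "q \<in> S1" for y q
    using adj_all[of S1 _ q y] not_both[of y] that by (auto simp: P2 nbhd_def)
  have P_nbhd1: "S1 \<subseteq> nbhd G y \<and> nbhd G y \<subseteq> S1 \<union> ?P1" if y: "y \<in> ?P1" for y
  proof -
    have "z \<in> S1 \<union> ?P1" if "(y, z) \<in> parcs G" for z
      using that PP[OF y, of z] P1_S2[OF y, of z] cover[of z] arcs by auto
    then have "nbhd G y \<subseteq> S1 \<union> ?P1" by (auto simp: nbhd_def)
    then show ?thesis using y P1 by blast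
  qed
  have P_nbhd2: "S2 \<subseteq> nbhd G y \<and> nbhd G y \<subseteq> S2 \<union> ?P2" if y: "y \<in> ?P2" for y
  proof -
    have "z \<in> S2 \<union> ?P2" if "(y, z) \<in> parcs G" for z
      using that PP[OF _ y, of z] comm[of y z] P2_S1[OF y, of z] cover[of z] arcs by auto
    then have "nbhd G y \<subseteq> S2 \<union> ?P2" by (auto simp: nbhd_def)
    then show ?thesis using y P2 by blast
  qed
  have "nbhd G x = S1 \<union> S2 \<union> ?P1 - {x}" if x: "x \<in> S1" for x
  proof -
    have "(x, z) \<in> parcs G \<longleftrightarrow> z \<in> S1 \<union> S2 \<union> ?P1 - {x}" for z
    proof
      assume xz: "(x, z) \<in> parcs G"
      then show "z \<in> S1 \<union> S2 \<union> ?P1 - {x}"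
        using P2_S1[OF _ x, of z] comm[of x z] cover[of z] arcs irr[of x] by auto
    next
      assume "z \<in> S1 \<union> S2 \<union> ?P1 - {x}"
      then show "(x, z) \<in> parcs G"
        using Q[of x z] x P1[of z] comm[of x z] by (auto simp: nbhd_def)
    qed
    then show ?thesis by (auto simp: nbhd_def)
  qed
  moreover have "nbhd G x = S1 \<union> S2 \<union> ?P2 - {x}" if x: "x \<in> S2" for x
  proof -
    have "(x, z) \<in> parcs G \<longleftrightarrow> z \<in> S1 \<union> S2 \<union> ?P2 - {x}" for z
    proof
      assume xz: "(x, z) \<in> parcs G"
      then show "z \<in> S1 \<union> S2 \<union> ?P2 - {x}"
        using P1_S2[OF _ x, of z] comm[of x z] cover[of z] arcs irr[of x] by auto
    next
      assume "z \<in> S1 \<union> S2 \<union> ?P2 - {x}"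
      then show "(x, z) \<in> parcs G"
        using Q[of x z] x P2[of z] comm[of x z] by (auto simp: nbhd_def)
    qed
    then show ?thesis by (auto simp: nbhd_def)
  qed
  moreover have "pverts G = S1 \<union> S2 \<union> ?P1 \<union> ?P2"
    using sub cover P1 P2 by blast
  moreover have "?Q \<inter> (?P1 \<union> ?P2) = {}" "?P1 \<inter> ?P2 = {}"
    using P1 P2 not_both by blast+
  moreover have "clique G (nbhd G x)" if "x \<in> ?P1 \<union> ?P2" for x
    using that by (auto simp: simplicial_at_def simplicial_def)
  ultimately have "si_core G S1 S2 ?P1 ?P2 s p"
    using pg disj cards cardp P_nbhd1 P_nbhd2 by (intro si_core.intro) simp_all
  then show thesis by (rule that)
qed

section \<open>Laplacian eigenfunctions\<close>

text \<open>The equation \<open>L r = k r\<close> evaluated at each vertex, with the degree term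
  distributed over the neighbours.\<close>

definition laplacian_eigenfunction :: "'a pair_pre_digraph \<Rightarrow> ('a \<Rightarrow> complex) \<Rightarrow> complex \<Rightarrow> bool" where
  "laplacian_eigenfunction G r k \<longleftrightarrow>
     (\<forall>w\<in>pverts G. (\<Sum>u\<in>nbhd G w. r w - r u) = k * r w)"

lemma finite_nbhd: "pair_graph G \<Longrightarrow> finite (nbhd G w)"
  by (rule finite_subset[of _ "pverts G"]) (auto simp: pair_graph_iff nbhd_def)

text \<open>By symmetry of adjacency the entry is expressed through the neighbourhood of the column
  vertex, which suits multiplication by a row vector from the left.\<close>

lemma laplacian_entry:
  assumes "pair_graph G" "distinct vs" "i < length vs" "j < length vs"
  shows "laplacian_matrix G vs $$ (i, j) =
    (if vs ! i = vs ! j then of_nat (card (nbhd G (vs ! j))) else 0) -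
    (if vs ! i \<in> nbhd G (vs ! j) then 1 else 0)"
proof -
  have "(vs ! i, vs ! j) \<in> parcs G \<longleftrightarrow> vs ! i \<in> nbhd G (vs ! j)"
    using assms(1) by (auto simp: pair_graph_iff nbhd_def dest: symD)
  then show ?thesis
    using assms by (simp add: laplacian_matrix_def degree_matrix_def adjacency_matrix_def
        nth_eq_iff_index_eq)
qed

text \<open>Each vertex \<open>u\<close> other than \<open>a\<close> and \<open>b\<close> is
  assigned an eigenfunction, and \<open>\<Phi> u x\<close> records what follows when
  \<open>x\<close> pairs to zero with it. Linear independence is tested dually: if all these
  conditions and the vanishing of \<open>x\<close> at \<open>a\<close> and \<open>b\<close> force
  \<open>x\<close> to be zero on the vertices, then the square matrix of the assigned functions and
  the two indicators is invertible.\<close>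

lemma num_nonint_laplacian_corank2:
  assumes pg: "pair_graph G" and vs: "distinct vs" "set vs = pverts G"
    and ab: "a \<in> pverts G" "b \<in> pverts G" "a \<noteq> b"
    and ex: "\<And>u. u \<in> pverts G - {a, b} \<Longrightarrow> \<exists>r k. k \<in> \<int> \<and> laplacian_eigenfunction G r k \<and>
      (\<forall>x. (\<Sum>w\<in>pverts G. r w * x w) = 0 \<longrightarrow> \<Phi> u x)"
    and ker: "\<And>x. (\<And>u. u \<in> pverts G - {a, b} \<Longrightarrow> \<Phi> u x) \<Longrightarrow> x a = 0 \<Longrightarrow> x b = 0 \<Longrightarrow>
      \<forall>w\<in>pverts G. x w = 0"
  shows "num_nonint_eigenvalues (laplacian_matrix G vs) = 0 \<or>
    num_nonint_eigenvalues (laplacian_matrix G vs) = 2"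
proof -
  have fin: "finite (pverts G)" using pg by (simp add: pair_graph_iff)
  have "\<forall>u\<in>pverts G - {a, b}. \<exists>rk. snd rk \<in> \<int> \<and> laplacian_eigenfunction G (fst rk) (snd rk) \<and>
      (\<forall>x. (\<Sum>w\<in>pverts G. fst rk w * x w) = 0 \<longrightarrow> \<Phi> u x)"
    using ex by simp
  then obtain rk where rk: "\<And>u. u \<in> pverts G - {a, b} \<Longrightarrow> snd (rk u) \<in> \<int> \<and>
      laplacian_eigenfunction G (fst (rk u)) (snd (rk u)) \<and>
      (\<forall>x. (\<Sum>w\<in>pverts G. fst (rk u) w * x w) = 0 \<longrightarrow> \<Phi> u x)"
    by (metis bchoice)
  define \<rho> where "\<rho> u = (if u = a \<or> u = b then (\<lambda>w. if w = u then 1 else 0) else fst (rk u))" for u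
  obtain as where as: "distinct as" "set as = pverts G - {a, b}"
    using fin by (metis finite_Diff finite_distinct_list)
  \<comment> \<open>Rows are ordered with \<open>a\<close> and \<open>b\<close> last, so that the
    first \<open>m\<close> rows are the eigenfunctions.\<close>
  define us where "us = as @ [a, b]"
  define m where "m = length as"
  have us: "distinct us" "set us = pverts G" "length us = m + 2"
    using as ab by (auto simp: us_def m_def)
  have len: "length vs = m + 2"
    using us vs by (metis distinct_card)
  have us_nth: "us ! i \<in> pverts G - {a, b}" if "i < m" for i
    using that as nth_mem[of i as] by (auto simp: us_def m_def nth_append)
  have sum_V: "(\<Sum>w\<in>pverts G. g w) = (\<Sum>j<m + 2. g (vs ! j))" for g :: "'a \<Rightarrow> complex"
    using sum.reindex_bij_betw[OF bij_betw_nth[OF vs(1) refl refl], of g] vs len by simp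
  let ?L = "laplacian_matrix G vs"
  define R where "R = mat (m + 2) (m + 2) (\<lambda>(i, j). \<rho> (us ! i) (vs ! j))"
  have L: "?L \<in> carrier_mat (m + 2) (m + 2)"
    using len by (auto simp: laplacian_matrix_def degree_matrix_def adjacency_matrix_def)
  have R: "R \<in> carrier_mat (m + 2) (m + 2)" by (simp add: R_def)
  show ?thesis
  proof (rule num_nonint_eigenvalues_corank2[OF L R, where k = "\<lambda>i. snd (rk (us ! i))"])
    show "snd (rk (us ! i)) \<in> \<int>" if "i < m" for i
      using rk us_nth[OF that] by blast
    show "(\<Sum>i<m + 2. ?L $$ (i, i)) \<in> \<int>"
      using len by (intro Ints_sum) (auto simp: laplacian_entry[OF pg vs(1)])
  next
    show "det R \<noteq> 0"
    proof
      assume "det R = 0"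
      then obtain v where v: "v \<in> carrier_vec (m + 2)" "v \<noteq> 0\<^sub>v (m + 2)" "R *\<^sub>v v = 0\<^sub>v (m + 2)"
        unfolding det_0_iff_vec_prod_zero[OF R] by blast
      \<comment> \<open>A kernel vector, indexed by positions in \<open>vs\<close>, is read back as
        a function on vertices.\<close>
      define x where "x w = v $ (inv_into {..<m + 2} ((!) vs) w)" for w
      have inj: "inj_on ((!) vs) {..<m + 2}"
        using vs(1) len by (auto simp: inj_on_def nth_eq_iff_index_eq)
      have x: "x (vs ! j) = v $ j" if "j < m + 2" for j
        using that inv_into_f_f[OF inj, of j] by (simp add: x_def)
      have zero: "(\<Sum>w\<in>pverts G. \<rho> u w * x w) = 0" if u: "u \<in> pverts G" for u
      proof -
        obtain i where i: "i < m + 2" "us ! i = u"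
          using u us by (metis in_set_conv_nth)
        have "0 = (R *\<^sub>v v) $ i" using v(3) i by simp
        also have "\<dots> = (\<Sum>j<m + 2. R $$ (i, j) * v $ j)"
          using i(1) R v(1) by (simp add: scalar_prod_def lessThan_atLeast0 del: sum.lessThan_Suc)
        also have "\<dots> = (\<Sum>j<m + 2. \<rho> u (vs ! j) * x (vs ! j))"
          using i x by (intro sum.cong) (auto simp: R_def)
        finally show ?thesis by (simp add: sum_V)
      qed
      have "\<forall>w\<in>pverts G. x w = 0"
      proof (rule ker)
        show "\<Phi> u x" if "u \<in> pverts G - {a, b}" for u
          using rk[OF that] zero[of u] that by (auto simp: \<rho>_def)
        have delta: "(\<Sum>w\<in>pverts G. (if w = c then 1 else 0) * x w) = x c" if "c \<in> pverts G" for c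
          using that fin by (simp add: if_distrib[of "\<lambda>t. t * _"] cong: if_cong)
        show "x a = 0" "x b = 0"
          using zero[of a] zero[of b] delta[of a] delta[of b] ab by (simp_all add: \<rho>_def)
      qed
      then have "v $ j = 0" if "j < m + 2" for j
        using x[OF that] that len vs(2) nth_mem[of j vs] by auto
      then have "v = 0\<^sub>v (m + 2)" using v(1) by (intro eq_vecI) auto
      with v(2) show False ..
    qed
  next
    show "(R * ?L) $$ (i, j) = snd (rk (us ! i)) * R $$ (i, j)"
      if i: "i < m" and j: "j < m + 2" for i j
    proof -
      let ?r = "fst (rk (us ! i))" and ?w = "vs ! j"
      have w: "?w \<in> pverts G" using j len vs by (metis nth_mem)
      have r: "\<rho> (us ! i) = ?r" using us_nth[OF i] by (auto simp: \<rho>_def)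
      have sub: "nbhd G ?w \<subseteq> pverts G" using pg by (auto simp: pair_graph_iff nbhd_def)
      have "(R * ?L) $$ (i, j) = (\<Sum>l<m + 2. R $$ (i, l) * ?L $$ (l, j))"
        using i j by (intro index_mult_mat_sum[OF R L]) auto
      also have "\<dots> = (\<Sum>l<m + 2. ?r (vs ! l) *
          ((if vs ! l = ?w then of_nat (card (nbhd G ?w)) else 0) - (if vs ! l \<in> nbhd G ?w then 1 else 0)))"
        using i j len laplacian_entry[OF pg vs(1)] r by (intro sum.cong) (auto simp: R_def)
      also have "\<dots> = (\<Sum>u\<in>pverts G. ?r u *
          ((if u = ?w then of_nat (card (nbhd G ?w)) else 0) - (if u \<in> nbhd G ?w then 1 else 0)))"
        by (simp only: sum_V)
      also have "\<dots> = (\<Sum>u\<in>pverts G. if u = ?w then ?r u * of_nat (card (nbhd G ?w)) else 0) -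
          (\<Sum>u\<in>pverts G. if u \<in> nbhd G ?w then ?r u else 0)"
        unfolding sum_subtractf[symmetric] by (intro sum.cong) (auto simp: algebra_simps)
      also have "\<dots> = ?r ?w * of_nat (card (nbhd G ?w)) - (\<Sum>u\<in>nbhd G ?w. ?r u)"
        using w fin sub by (simp add: sum.inter_restrict[symmetric] Int_absorb1)
      also have "\<dots> = (\<Sum>u\<in>nbhd G ?w. ?r ?w - ?r u)"
        by (simp add: sum_subtractf mult.commute)
      also have "\<dots> = snd (rk (us ! i)) * ?r ?w"
        using rk[OF us_nth[OF i]] w by (auto simp: laplacian_eigenfunction_def)
      finally show ?thesis using i j r by (simp add: R_def)
    qed
  qed
qed

text \<open>A vertex other than \<open>u\<close> and \<open>c\<close> sees both or neither, so the
  values cancel there. At \<open>u\<close> the neighbour \<open>c\<close> contributes 2 and every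
  other neighbour 1, giving the degree plus one; at \<open>c\<close> the signs are reversed.\<close>

lemma twins_eigenfunction:
  assumes pg: "pair_graph G" and "u \<noteq> c" and cn: "closed_nbhd G u = closed_nbhd G c"
  shows "laplacian_eigenfunction G (\<lambda>z. (if z = u then 1 else 0) - (if z = c then 1 else 0))
    (of_nat (card (closed_nbhd G u)))"
  unfolding laplacian_eigenfunction_def
proof
  fix w assume w: "w \<in> pverts G"
  let ?r = "\<lambda>z. (if z = u then 1 else 0) - (if z = c then 1 else 0 :: complex)"
  have fin: "finite (nbhd G w)" for w by (rule finite_nbhd[OF pg])
  have irr: "w \<notin> nbhd G w" for w using pg by (auto simp: pair_graph_iff nbhd_def)
  have comm: "x \<in> nbhd G y \<longleftrightarrow> y \<in> nbhd G x" for x y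
    using pg by (auto simp: pair_graph_iff nbhd_def dest: symD)
  have deg: "card (closed_nbhd G w) = Suc (card (nbhd G w))" for w
    using fin irr by (simp add: closed_nbhd_def)
  have uc: "u \<in> nbhd G c" "c \<in> nbhd G u"
    using cn \<open>u \<noteq> c\<close> by (auto simp: closed_nbhd_def)
  have iff: "u \<in> nbhd G w \<longleftrightarrow> c \<in> nbhd G w" if "w \<noteq> u" "w \<noteq> c"
    using cn that comm unfolding closed_nbhd_def by blast
  have "(\<Sum>z\<in>nbhd G w. ?r w - ?r z) = of_nat (card (nbhd G w)) * ?r w -
      ((if u \<in> nbhd G w then 1 else 0) - (if c \<in> nbhd G w then 1 else 0))"
    using fin by (simp add: sum_subtractf)
  also have "\<dots> = of_nat (card (closed_nbhd G u)) * ?r w"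
    using iff uc irr \<open>u \<noteq> c\<close> deg[of u] deg[of c] cn by auto
  finally show "(\<Sum>z\<in>nbhd G w. ?r w - ?r z) = of_nat (card (closed_nbhd G u)) * ?r w" .
qed

section \<open>Eigenfunctions of the core graphs\<close>

context si_core
begin

text \<open>The structure is symmetric in its two sides, so facts proved for \<open>S1\<close> and
  \<open>P1\<close> transfer to \<open>S2\<close> and \<open>P2\<close>.\<close>

lemma swap: "si_core G S2 S1 P2 P1 s p"
  using pair_graph verts disjoint card nbhd_S1 nbhd_S2 nbhd_P1 nbhd_P2 clique_nbhd
  by (intro si_core.intro) (simp_all add: Un_ac Int_commute)

lemma disj:
  "x \<in> S1 \<Longrightarrow> x \<notin> S2" "x \<in> S1 \<Longrightarrow> x \<notin> P1" "x \<in> S1 \<Longrightarrow> x \<notin> P2"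
  "x \<in> S2 \<Longrightarrow> x \<notin> P1" "x \<in> S2 \<Longrightarrow> x \<notin> P2" "x \<in> P1 \<Longrightarrow> x \<notin> P2"
  using disjoint by auto

lemma finite_parts: "finite S1" "finite S2" "finite P1" "finite P2"
proof -
  have "finite (pverts G)" using pair_graph by (simp add: pair_graph_iff)
  then show "finite S1" "finite S2" "finite P1" "finite P2" by (simp_all add: verts)
qed

lemma sum_verts:
  "(\<Sum>w\<in>pverts G. g w) = sum g S1 + sum g S2 + sum g P1 + (sum g P2 :: complex)"
proof -
  have "(S1 \<union> S2 \<union> P1) \<inter> P2 = {}" "(S1 \<union> S2) \<inter> P1 = {}" using disjoint by auto
  then show ?thesis
    using disjoint finite_parts by (simp add: verts sum.union_disjoint)
qed

lemma nbhd_P1_eq: "w \<in> P1 \<Longrightarrow> nbhd G w = S1 \<union> (nbhd G w \<inter> P1)"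
  using nbhd_P1[of w] by blast

lemma sum_nbhd_P1:
  assumes "w \<in> P1"
  shows "(\<Sum>z\<in>nbhd G w. g z) = sum g S1 + (\<Sum>z\<in>nbhd G w \<inter> P1. g z :: complex)"
proof -
  have "S1 \<inter> (nbhd G w \<inter> P1) = {}" using disjoint by auto
  then show ?thesis
    using nbhd_P1_eq[OF assms] finite_parts sum.union_disjoint[of S1 "nbhd G w \<inter> P1" g] by simp
qed

lemma sum_nbhd_S1:
  assumes "w \<in> S1"
  shows "(\<Sum>z\<in>nbhd G w. g z) = (\<Sum>z\<in>S1 \<union> S2 - {w}. g z) + (sum g P1 :: complex)"
proof -
  have "nbhd G w = (S1 \<union> S2 - {w}) \<union> P1" "(S1 \<union> S2 - {w}) \<inter> P1 = {}"
    using nbhd_S1[OF assms] disjoint assms by auto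
  then show ?thesis using finite_parts by (simp add: sum.union_disjoint)
qed

text \<open>At \<open>w\<close> in \<open>P1\<close> only the \<open>s\<close> neighbours in
  \<open>S1\<close> contribute, each with \<open>r w\<close>. At a vertex of \<open>S1\<close> the
  contributions sum to zero with \<open>r\<close>, and the remaining vertices have no neighbour in
  \<open>P1\<close>.\<close>

lemma eigenfunction_on_P1:
  assumes supp: "\<And>z. z \<notin> P1 \<Longrightarrow> r z = 0" and sum: "sum r P1 = 0"
    and const: "\<And>z w. w \<in> P1 \<Longrightarrow> z \<in> nbhd G w \<inter> P1 \<Longrightarrow> r z = r w"
  shows "laplacian_eigenfunction G r (of_nat s)"
  unfolding laplacian_eigenfunction_def
proof
  fix w assume "w \<in> pverts G"
  then consider "w \<in> P1" | "w \<in> S1" | "w \<in> S2 \<union> P2" by (auto simp: verts)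
  then show "(\<Sum>z\<in>nbhd G w. r w - r z) = of_nat s * r w"
  proof cases
    case 1
    have "(\<Sum>z\<in>S1. r w - r z) = (\<Sum>z\<in>S1. r w)"
      by (intro sum.cong) (auto simp: supp disj)
    moreover have "(\<Sum>z\<in>nbhd G w \<inter> P1. r w - r z) = 0"
      using const[OF 1] by (intro sum.neutral) simp
    ultimately show ?thesis
      using card by (simp add: sum_nbhd_P1[OF 1])
  next
    case 2
    have rw: "r w = 0" using 2 by (intro supp) (simp add: disj)
    have "(\<Sum>z\<in>S1 \<union> S2 - {w}. r w - r z) = 0"
      using rw by (intro sum.neutral) (auto simp: supp disj)
    then show ?thesis
      using sum rw by (simp add: sum_nbhd_S1[OF 2] sum_negf)
  next
    case 3
    then have "nbhd G w \<subseteq> S1 \<union> S2 \<union> P2"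
      using nbhd_S2[of w] nbhd_P2[of w] by auto
    then have "nbhd G w \<inter> P1 = {}" "w \<notin> P1"
      using 3 disjoint by blast+
    then have "r w = 0" and "\<And>z. z \<in> nbhd G w \<Longrightarrow> r z = 0"
      by (auto intro: supp)
    then show ?thesis by simp
  qed
qed

definition separator_eigenfunction :: "'a \<Rightarrow> complex" where
  "separator_eigenfunction w = (if w \<in> S1 \<union> S2 then of_nat p else - of_nat s)"

text \<open>Only arcs between \<open>S1\<close> and \<open>P1\<close> contribute, with difference
  \<open>s + p\<close> up to sign. A vertex of \<open>S1\<close> has \<open>p\<close> of them and a
  vertex of \<open>P1\<close> has \<open>s\<close>, which matches the values \<open>p\<close> and
  \<open>-s\<close>.\<close>

lemma separator_eigenfunction_half:
  assumes "w \<in> S1 \<union> P1"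
  shows "(\<Sum>z\<in>nbhd G w. separator_eigenfunction w - separator_eigenfunction z) =
    of_nat (s + p) * separator_eigenfunction w"
  using assms
proof
  assume w: "w \<in> S1"
  let ?g = "\<lambda>z. separator_eigenfunction w - separator_eigenfunction z"
  have "sum ?g (S1 \<union> S2 - {w}) = 0"
    using w by (intro sum.neutral) (auto simp: separator_eigenfunction_def)
  moreover have "sum ?g P1 = (\<Sum>z\<in>P1. of_nat p + of_nat s)"
    using w disjoint by (intro sum.cong) (auto simp: separator_eigenfunction_def)
  ultimately show ?thesis
    using w card by (simp add: sum_nbhd_S1 separator_eigenfunction_def algebra_simps)
next
  assume w: "w \<in> P1"
  let ?g = "\<lambda>z. separator_eigenfunction w - separator_eigenfunction z"
  have gw: "separator_eigenfunction w = - of_nat s"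
    using w by (auto simp: separator_eigenfunction_def disj)
  have "sum ?g S1 = (\<Sum>z\<in>S1. - of_nat s - of_nat p)"
    by (intro sum.cong) (auto simp: gw, simp add: separator_eigenfunction_def)
  also have "\<dots> = of_nat (s + p) * separator_eigenfunction w"
    using card by (simp add: gw algebra_simps)
  finally have "sum ?g S1 = of_nat (s + p) * separator_eigenfunction w" .
  moreover have "sum ?g (nbhd G w \<inter> P1) = 0"
    by (intro sum.neutral) (auto simp: gw, auto simp: separator_eigenfunction_def disj)
  ultimately show ?thesis
    unfolding sum_nbhd_P1[OF w] by simp
qed

lemma separator_eigenfunction:
  "laplacian_eigenfunction G separator_eigenfunction (of_nat (s + p))"
proof -
  have eq: "si_core.separator_eigenfunction S2 S1 s p = separator_eigenfunction"
    unfolding si_core.separator_eigenfunction_def[OF swap] separator_eigenfunction_def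
    by (simp add: Un_commute)
  show ?thesis
    unfolding laplacian_eigenfunction_def verts
    using separator_eigenfunction_half si_core.separator_eigenfunction_half[OF swap, unfolded eq]
    by blast
qed

lemma closed_nbhd_S1: "u \<in> S1 \<Longrightarrow> closed_nbhd G u = S1 \<union> S2 \<union> P1"
  using nbhd_S1[of u] by (auto simp: closed_nbhd_def)

lemma closed_nbhd_S2: "u \<in> S2 \<Longrightarrow> closed_nbhd G u = S1 \<union> S2 \<union> P2"
  using nbhd_S2[of u] by (auto simp: closed_nbhd_def)

text \<open>For \<open>u\<close> in \<open>P1\<close> or \<open>P2\<close> this is the vertex set of
  the complete component of \<open>u\<close> in the subgraph induced by that part.\<close>

definition cls :: "'a \<Rightarrow> 'a set" where
  "cls u = closed_nbhd G u - (S1 \<union> S2)"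

text \<open>A clique neighbourhood gives \<open>closed_nbhd G x \<subseteq> closed_nbhd G y\<close>
  for each \<open>y\<close> next to \<open>x\<close>; applied in both directions, members of one
  component are true twins.\<close>

lemma closed_nbhd_P:
  assumes u: "u \<in> P1 \<union> P2" and c: "c \<in> cls u"
  shows "closed_nbhd G c = closed_nbhd G u" "c \<in> P1 \<union> P2" "c \<in> P1 \<longleftrightarrow> u \<in> P1"
proof -
  have sym: "sym (parcs G)" using pair_graph by (simp add: pair_graph_iff)
  show cP: "c \<in> P1 \<union> P2" "c \<in> P1 \<longleftrightarrow> u \<in> P1"
    using u c nbhd_P1[of u] nbhd_P2[of u] disj(6)[of u] disj(6)[of c]
    by (auto simp: cls_def closed_nbhd_def)
  have sub: "closed_nbhd G x \<subseteq> closed_nbhd G y"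
    if "x \<in> P1 \<union> P2" "y \<in> closed_nbhd G x" for x y
  proof
    fix z assume "z \<in> closed_nbhd G x"
    then show "z \<in> closed_nbhd G y"
      using clique_nbhd[OF that(1)] that(2) symD[OF sym, of x y]
      by (auto simp: clique_def closed_nbhd_def nbhd_def)
  qed
  have "c \<in> closed_nbhd G u" using c by (simp add: cls_def)
  moreover have "u \<in> closed_nbhd G c"
    using calculation symD[OF sym, of u c] by (auto simp: closed_nbhd_def nbhd_def)
  ultimately show "closed_nbhd G c = closed_nbhd G u"
    using sub u cP(1) by blast
qed

lemma self_in_cls: "u \<in> P1 \<union> P2 \<Longrightarrow> u \<in> cls u"
  using disjoint by (auto simp: cls_def closed_nbhd_def)

lemma cls_eq: "u \<in> P1 \<union> P2 \<Longrightarrow> c \<in> cls u \<Longrightarrow> cls c = cls u"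
  using closed_nbhd_P(1) by (simp add: cls_def)

lemma cls_subset_P1: "u \<in> P1 \<Longrightarrow> cls u \<subseteq> P1"
  using closed_nbhd_P(3)[of u] by blast

text \<open>The witness is a difference of two class indicators, each divided by its class size. It
  pairs with a function constant on both classes to the difference of the two values.\<close>

lemma class_eigenfunction:
  assumes u: "u \<in> P1" and c: "c \<in> P1" and ne: "cls u \<noteq> cls c"
  shows "\<exists>r. laplacian_eigenfunction G r (of_nat s) \<and>
    (\<forall>x. (\<Sum>w\<in>pverts G. r w * x w) = 0 \<longrightarrow>
      (\<forall>z\<in>cls u. x z = x u) \<longrightarrow> (\<forall>z\<in>cls c. x z = x c) \<longrightarrow> x u = x c)"
proof -
  let ?m = "\<lambda>v z. if z \<in> cls v then 1 / of_nat (card (cls v)) else 0 :: complex"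
  define r where "r z = ?m u z - ?m c z" for z
  have sub: "cls u \<subseteq> P1" "cls c \<subseteq> P1" using cls_subset_P1 u c by auto
  have avg: "(\<Sum>w\<in>P1. ?m v w * x w) = x v" if v: "v \<in> P1" and x: "\<forall>z\<in>cls v. x z = x v" for v x
  proof -
    have fin: "finite (cls v)" "cls v \<noteq> {}"
      using cls_subset_P1[OF v] finite_parts self_in_cls[of v] v by (auto intro: finite_subset)
    have "(\<Sum>w\<in>P1. ?m v w * x w) = (\<Sum>w\<in>P1. if w \<in> cls v then x v / of_nat (card (cls v)) else 0)"
      using x by (intro sum.cong) auto
    also have "\<dots> = (\<Sum>w\<in>cls v. x v / of_nat (card (cls v)))"
      using finite_parts cls_subset_P1[OF v]
      by (simp only: sum.inter_restrict[symmetric] Int_absorb1)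
    also have "\<dots> = x v"
      using fin by simp
    finally show ?thesis .
  qed
  have supp: "r z = 0" if "z \<notin> P1" for z
    using that sub by (auto simp: r_def)
  have pair: "(\<Sum>w\<in>P1. r w * x w) = x u - x c"
    if "\<forall>z\<in>cls u. x z = x u" "\<forall>z\<in>cls c. x z = x c" for x
    unfolding r_def left_diff_distrib sum_subtractf using avg u c that by simp
  have "laplacian_eigenfunction G r (of_nat s)"
  proof (rule eigenfunction_on_P1[OF supp])
    \<comment> \<open>Pairing with the constant function 1 gives the sum of
      \<open>r\<close>.\<close>
    show "sum r P1 = 0" using pair[of "\<lambda>_. 1"] by simp
    fix z w assume w: "w \<in> P1" and z: "z \<in> nbhd G w \<inter> P1"
    have "z \<in> cls w" using z disjoint by (auto simp: cls_def closed_nbhd_def)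
    then have "cls z = cls w" using cls_eq w by blast
    moreover have "y \<in> cls v \<longleftrightarrow> cls y = cls v" if "v \<in> P1" "y \<in> P1" for v y
      using that cls_eq self_in_cls by blast
    ultimately show "r z = r w" using u c w z by (simp add: r_def)
  qed
  moreover have "(\<Sum>w\<in>pverts G. r w * x w) = (\<Sum>w\<in>P1. r w * x w)" for x
  proof -
    have zero: "(\<Sum>w\<in>A. r w * x w) = 0" if "A \<inter> P1 = {}" for A
      using that by (intro sum.neutral) (auto intro!: supp)
    have "(\<Sum>w\<in>S1. r w * x w) = 0" "(\<Sum>w\<in>S2. r w * x w) = 0" "(\<Sum>w\<in>P2. r w * x w) = 0"
      using disjoint by (auto intro!: zero)
    then show ?thesis by (simp add: sum_verts)
  qed
  ultimately show ?thesis using pair by (metis eq_iff_diff_eq_0)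
qed

text \<open>Constants are assigned to \<open>a1\<close>, the separator eigenfunction to
  \<open>b1\<close>, twin differences to the other vertices of \<open>S1\<close> and
  \<open>S2\<close> and to non-representatives of components, and class differences to the remaining
  representatives. The vertices \<open>a2\<close> and \<open>b2\<close> are left over and account
  for the two exceptional dimensions.\<close>

lemma num_nonint_laplacian:
  assumes s: "s > 0" and p: "p > 0" and vs: "distinct vs" "set vs = pverts G"
  shows "num_nonint_eigenvalues (laplacian_matrix G vs) = 0 \<or>
    num_nonint_eigenvalues (laplacian_matrix G vs) = 2"
proof -
  \<comment> \<open>The choice depends on the set \<open>cls u\<close> alone, so all members of a
    component share one representative and \<open>rep\<close> is idempotent.\<close>
  define rep where "rep u = (SOME c. c \<in> cls u)" for u
  have rep: "rep u \<in> cls u" "cls (rep u) = cls u" "rep u \<in> P1 \<union> P2" "rep u \<in> P1 \<longleftrightarrow> u \<in> P1"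
    "rep (rep u) = rep u" "closed_nbhd G (rep u) = closed_nbhd G u" if u: "u \<in> P1 \<union> P2" for u
  proof -
    show 1: "rep u \<in> cls u" using someI[of "\<lambda>c. c \<in> cls u", OF self_in_cls[OF u]]
      by (simp add: rep_def)
    show 2: "cls (rep u) = cls u" using cls_eq[OF u 1] .
    show "rep u \<in> P1 \<union> P2" "rep u \<in> P1 \<longleftrightarrow> u \<in> P1" "closed_nbhd G (rep u) = closed_nbhd G u"
      using closed_nbhd_P[OF u 1] by auto
    show "rep (rep u) = rep u" using 2 by (simp add: rep_def)
  qed
  obtain a1 a2 q1 q2 where a: "a1 \<in> S1" "a2 \<in> S2" and q: "q1 \<in> P1" "q2 \<in> P2"
    using card s p by (metis card_gt_0_iff ex_in_conv)
  define b1 b2 where "b1 = rep q1" and "b2 = rep q2"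
  have b: "b1 \<in> P1" "b2 \<in> P2" "rep b1 = b1" "rep b2 = b2"
    using rep(3-5)[of q1] rep(3-5)[of q2] q disjoint by (auto simp: b1_def b2_def)
  define base where "base u = (if u \<in> P1 then b1 else b2)" for u
  let ?const = "\<lambda>u (x :: 'a \<Rightarrow> complex). \<forall>z\<in>cls u. x z = x u"
  \<comment> \<open>The cases \<open>a1\<close> and \<open>b1\<close> precede the others since these
    vertices lie in \<open>S1\<close> and \<open>P1\<close> too. The premises in the last case,
    constancy on components, are later supplied by the twin differences.\<close>
  define \<Phi> :: "'a \<Rightarrow> ('a \<Rightarrow> complex) \<Rightarrow> bool" where "\<Phi> u x \<longleftrightarrow>
    (if u = a1 then (\<Sum>w\<in>pverts G. x w) = 0
     else if u = b1 then (\<Sum>w\<in>pverts G. separator_eigenfunction w * x w) = 0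
     else if u \<in> S1 then x u = x a1
     else if u \<in> S2 then x u = x a2
     else if rep u \<noteq> u then x u = x (rep u)
     else ?const u x \<longrightarrow> ?const (base u) x \<longrightarrow> x u = x (base u))" for u x
  have fin: "finite (pverts G)" using pair_graph by (simp add: pair_graph_iff)
  show ?thesis
  proof (rule num_nonint_laplacian_corank2[OF pair_graph vs, of a2 b2 \<Phi>])
    show "a2 \<in> pverts G" "b2 \<in> pverts G" "a2 \<noteq> b2"
      using a b disjoint by (auto simp: verts)
  next
    fix u assume u: "u \<in> pverts G - {a2, b2}"
    have twin: "\<exists>r k. k \<in> \<int> \<and> laplacian_eigenfunction G r k \<and>
        (\<forall>x. (\<Sum>w\<in>pverts G. r w * x w) = 0 \<longrightarrow> x u = x c)"
      if "u \<noteq> c" "closed_nbhd G u = closed_nbhd G c" "c \<in> pverts G" for c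
    proof -
      have "(\<Sum>w\<in>pverts G. ((if w = u then 1 else 0) - (if w = c then 1 else 0)) * x w) = x u - x c"
        for x :: "'a \<Rightarrow> complex"
        using fin u that(3)
        by (simp add: left_diff_distrib sum_subtractf if_distrib[of "\<lambda>t. t * _"] cong: if_cong)
      then show ?thesis
        using twins_eigenfunction[OF pair_graph that(1,2)]
        by (intro exI[of _ "\<lambda>w. (if w = u then 1 else 0) - (if w = c then 1 else 0)"]
            exI[of _ "of_nat (card (closed_nbhd G u))"]) simp
    qed
    consider "u = a1" | "u = b1" | "u \<noteq> a1" "u \<noteq> b1" "u \<in> S1" | "u \<noteq> a1" "u \<noteq> b1" "u \<in> S2"
      | "u \<noteq> b1" "u \<in> P1 \<union> P2" "rep u \<noteq> u" | "u \<noteq> b1" "u \<in> P1" "rep u = u"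
      | "u \<in> P2" "rep u = u"
      using u by (auto simp: verts)
    then show "\<exists>r k. k \<in> \<int> \<and> laplacian_eigenfunction G r k \<and>
        (\<forall>x. (\<Sum>w\<in>pverts G. r w * x w) = 0 \<longrightarrow> \<Phi> u x)"
    proof cases
      case 1
      then show ?thesis
        by (intro exI[of _ "\<lambda>_. 1"] exI[of _ 0])
           (auto simp: laplacian_eigenfunction_def \<Phi>_def)
    next
      case 2
      have "b1 \<noteq> a1" using a b disjoint by auto
      with 2 show ?thesis
        using separator_eigenfunction
        by (intro exI[of _ separator_eigenfunction] exI[of _ "of_nat (s + p)"])
           (auto simp: \<Phi>_def)
    next
      case 3
      then have "\<Phi> u x \<longleftrightarrow> x u = x a1" for x by (simp add: \<Phi>_def)
      then show ?thesis
        using twin[of a1] 3 a by (simp add: closed_nbhd_S1 verts)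
    next
      case 4
      then have "\<Phi> u x \<longleftrightarrow> x u = x a2" for x using disjoint by (auto simp: \<Phi>_def)
      then show ?thesis
        using twin[of a2] 4 a u by (simp add: closed_nbhd_S2 verts)
    next
      case 5
      then have "\<Phi> u x \<longleftrightarrow> x u = x (rep u)" for x using a disjoint by (auto simp: \<Phi>_def)
      then show ?thesis
        using twin[of "rep u"] 5 rep[OF 5(2)] by (auto simp: verts)
    next
      case 6
      then have \<Phi>: "\<Phi> u x \<longleftrightarrow> (?const u x \<longrightarrow> ?const b1 x \<longrightarrow> x u = x b1)" for x
        using a disjoint by (auto simp: \<Phi>_def base_def)
      have "cls u \<noteq> cls b1" using 6 b(3) by (auto simp: rep_def)
      from class_eigenfunction[OF 6(2) b(1) this] obtain r where
        "laplacian_eigenfunction G r (of_nat s)"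
        "\<forall>x. (\<Sum>w\<in>pverts G. r w * x w) = 0 \<longrightarrow> ?const u x \<longrightarrow> ?const b1 x \<longrightarrow> x u = x b1"
        by blast
      then show ?thesis
        by (intro exI[of _ r] exI[of _ "of_nat s"]) (simp add: \<Phi>)
    next
      case 7
      then have \<Phi>: "\<Phi> u x \<longleftrightarrow> (?const u x \<longrightarrow> ?const b2 x \<longrightarrow> x u = x b2)" for x
        using a b disjoint by (auto simp: \<Phi>_def base_def)
      have ne: "cls u \<noteq> cls b2" using 7 b(4) u by (auto simp: rep_def)
      have "si_core.cls G S2 S1 = cls"
        by (simp add: fun_eq_iff cls_def si_core.cls_def[OF swap] Un_commute)
      with si_core.class_eigenfunction[OF swap 7(1) b(2)] ne obtain r where
        "laplacian_eigenfunction G r (of_nat s)"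
        "\<forall>x. (\<Sum>w\<in>pverts G. r w * x w) = 0 \<longrightarrow> ?const u x \<longrightarrow> ?const b2 x \<longrightarrow> x u = x b2"
        by auto
      then show ?thesis
        by (intro exI[of _ r] exI[of _ "of_nat s"]) (simp add: \<Phi>)
    qed
  next
    \<comment> \<open>The twin and class conditions make \<open>x\<close> constant on each of the
      four parts, and zero on \<open>S2\<close> and \<open>P2\<close>. The constants and the
      separator eigenfunction then give two equations for the values on \<open>S1\<close> and
      \<open>P1\<close>.\<close>
    fix x assume *: "\<And>u. u \<in> pverts G - {a2, b2} \<Longrightarrow> \<Phi> u x" and x0: "x a2 = 0" "x b2 = 0"
    have ne: "a1 \<noteq> a2" "a1 \<noteq> b1" "a1 \<noteq> b2" "a2 \<noteq> b1" "b1 \<noteq> b2"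
      using a b disj by blast+
    have S1: "x u = x a1" if u: "u \<in> S1" for u
    proof -
      have "u \<noteq> a2" "u \<noteq> b1" "u \<noteq> b2" using u a b disj by blast+
      then show ?thesis
        using *[of u] u by (cases "u = a1") (simp_all add: \<Phi>_def verts)
    qed
    have S2: "x u = 0" if u: "u \<in> S2" for u
    proof -
      have "u \<noteq> a1" "u \<noteq> b1" "u \<noteq> b2" "u \<notin> S1" using u a b disj by blast+
      then show ?thesis
        using *[of u] u x0 by (cases "u = a2") (simp_all add: \<Phi>_def verts)
    qed
    have \<Phi>P: "\<Phi> u x \<longleftrightarrow> (if rep u \<noteq> u then x u = x (rep u)
        else ?const u x \<longrightarrow> ?const (base u) x \<longrightarrow> x u = x (base u))" "\<Phi> u x"
      if u: "u \<in> P1 \<union> P2" "u \<noteq> b1" "u \<noteq> b2" for u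
    proof -
      have "u \<noteq> a1" "u \<noteq> a2" "u \<notin> S1" "u \<notin> S2" using u(1) a disj by blast+
      then show "\<Phi> u x \<longleftrightarrow> (if rep u \<noteq> u then x u = x (rep u)
          else ?const u x \<longrightarrow> ?const (base u) x \<longrightarrow> x u = x (base u))" "\<Phi> u x"
        using *[of u] u by (auto simp: \<Phi>_def verts)
    qed
    have rep_x: "x u = x (rep u)" if u: "u \<in> P1 \<union> P2" for u
    proof (cases "rep u = u")
      case False
      then have "u \<noteq> b1" "u \<noteq> b2" using b by auto
      then show ?thesis using \<Phi>P[OF u] False by simp
    qed simp
    have const: "?const u x" if "u \<in> P1 \<union> P2" for u
    proof
      fix z assume z: "z \<in> cls u"
      then have "z \<in> P1 \<union> P2" "rep z = rep u"
        using closed_nbhd_P(2)[OF that z] cls_eq[OF that z] by (auto simp: rep_def)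
      then show "x z = x u" using rep_x that by metis
    qed
    have base_x: "x u = x (base u)" if u: "u \<in> P1 \<union> P2" for u
    proof -
      have "base (rep u) = base u" using rep(4)[OF u] by (simp add: base_def)
      moreover have "x (rep u) = x (base (rep u))"
      proof (cases "rep u \<in> {b1, b2}")
        case True
        then show ?thesis using b disjoint by (auto simp: base_def)
      next
        case False
        have "base (rep u) \<in> P1 \<union> P2" using b by (simp add: base_def)
        then show ?thesis
          using \<Phi>P[OF rep(3)[OF u]] False rep(5)[OF u] const[OF rep(3)[OF u]]
            const[of "base (rep u)"] by simp
      qed
      ultimately show ?thesis using rep_x[OF u] by simp
    qed
    have P1: "x u = x b1" if "u \<in> P1" for u
      using base_x[of u] that by (simp add: base_def)
    have P2: "x u = 0" if "u \<in> P2" for u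
      using base_x[of u] that disjoint x0 by (auto simp: base_def)
    have "(\<Sum>w\<in>pverts G. x w) = 0"
      using *[of a1] a ne by (simp add: \<Phi>_def verts)
    then have e1: "of_nat s * x a1 + of_nat p * x b1 = 0"
      using S1 S2 P1 P2 card by (simp add: sum_verts)
    have "(\<Sum>w\<in>pverts G. separator_eigenfunction w * x w) = 0"
      using *[of b1] b ne by (simp add: \<Phi>_def verts)
    moreover have "(\<Sum>w\<in>S1. separator_eigenfunction w * x w) = (\<Sum>w\<in>S1. of_nat p * x a1)"
      by (intro sum.cong) (auto simp: separator_eigenfunction_def S1)
    moreover have "(\<Sum>w\<in>P1. separator_eigenfunction w * x w) = (\<Sum>w\<in>P1. - of_nat s * x b1)"
      using disjoint by (intro sum.cong) (auto simp: separator_eigenfunction_def P1)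
    \<comment> \<open>This makes the two values equal, and \<open>e1\<close> then becomes
      \<open>s + p\<close> times their common value.\<close>
    ultimately have "of_nat s * of_nat p * (x a1 - x b1) = 0"
      using S2 P2 card by (simp add: sum_verts algebra_simps)
    then have e2: "x a1 = x b1" using s p by simp
    with e1 have "of_nat (s + p) * x b1 = 0" by (simp add: algebra_simps)
    then have "x b1 = 0" using s by (metis add_gr_0 mult_eq_0_iff of_nat_eq_0_iff less_numeral_extra(3))
    then show "\<forall>w\<in>pverts G. x w = 0"
      using S1 S2 P1 P2 e2 by (auto simp: verts)
  qed
qed

end

theorem theorem9:
  fixes s p :: nat and G :: "'a pair_pre_digraph" and vs :: "'a list"
  assumes "s \<ge> 2" and "p \<ge> 2"
    and "is_G_min s p G"
    and "distinct vs" and "set vs = pverts G"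
  shows "num_nonint_eigenvalues (laplacian_matrix G vs) = 0 \<or>
         num_nonint_eigenvalues (laplacian_matrix G vs) = 2"
proof -
  have "SI_core s p G"
    using assms(3) by (simp add: is_G_min_def is_arg_min_def)
  then obtain S1 S2 where "si_core G S1 S2 (simplicial_at G S1) (simplicial_at G S2) s p"
    using SI_core_imp_si_core assms(1) by (metis less_le_trans pos2)
  then show ?thesis
    using si_core.num_nonint_laplacian assms by fastforce
qed

end
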